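(* In the Kronecker model described in the context, let $g_1\in\mathcal G_L(k)$ and $g_2=\begin{pmatrix} g_{11} & 0 \\ g_{21} & g_{22} \end{pmatrix}\in\mathcal G_T(2)$ act on the data by $$g_1\circ(R_0,\Omega_0,\Phi)=(g_1R_0,\Omega_0,g_1\Phi g_1'),\qquad g_2\circ(R_0,\Omega_0,\Phi)=(R_0g_2',g_2\Omega_0g_2',\Phi),$$ and let $g_1$ and $g=(g_1,g_2)$ act on the parameters by $$g_1\circ(\Delta,\mu,\Omega_0,\Phi)=(\Delta,g_1\mu,\Omega_0,g_1\Phi g_1'),$$ $$g\circ(\Delta,\mu,\Sigma_0)=\Big(\frac{\Delta g_{11}}{\Delta g_{21}+g_{22}},\ g_1\mu(\Delta g_{21}+g_{22}),\ (g_2\otimes g_1)\Sigma_0(g_2'\otimes g_1')\Big),\qquad \Sigma_0=\Omega_0\otimes\Phi .$$ Then: (i) the induced group action of $g_2$ on the space of $([S:T],\Omega_0,\Phi)$ is $g_2\circ([S:T],\Omega_0,\Phi)=([\mathrm{sgn}(g_{11})S:\mathrm{sgn}(g_{22})T],\,g_2\Omega_0g_2',\,\Phi)$; (ii) the data maximal invariant to $g=(g_1,g_2)$ is $(Q_S,Q_T,Q_{ST}^2)$, where $Q_S=S'S$, $Q_T=T'T$, $Q_{ST}=S'T$; (iii) the induced group action by $g_2$ on the parameter functions is given by $g_2\circ(c_\beta\mu,d_\beta\mu,\Omega_0,\Phi)=(\mathrm{sgn}(g_{11})c_\beta\mu,\ \mathrm{sgn}(g_{22})d_\beta\mu,\ g_2\Omega_0g_2',\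 \Phi)$; and (iv) the parameter maximal invariant to $g=(g_1,g_2)$ is $(c_\beta^2\lambda,\ d_\beta^2\lambda,\ |c_\beta d_\beta|\lambda)$.
   Context: Model: fix $\beta_0\in\mathbb R$ and let $B_0=\begin{pmatrix} 1 & 0 \\ -\beta_0 & 1 \end{pmatrix}$, $a_0=(\beta_0,1)'$, $b_0=(1,-\beta_0)'$. $R$ is a random $k\times2$ matrix with $\mathrm{vec}(R)\sim N(a\otimes\mu,\Omega\otimes\Phi)$, where $a=(\beta,1)'$, $\beta\in\mathbb R$, $\mu\in\mathbb R^k$, $\Omega$ is a $2\times2$ and $\Phi$ a $k\times k$ positive definite matrix. Put $R_0=RB_0$, $\Omega_0=B_0'\Omega B_0$, $\Delta=\beta-\beta_0$, so that $\mathrm{vec}(R_0)\sim N((\Delta,1)'\otimes\mu,\Omega_0\otimes\Phi)$. The matrices $\Omega_0,\Phi$ are known but not fixed: the data are $(R_0,\Omega_0,\Phi)$ and the parameters are $(\Delta,\mu,\Omega_0,\Phi)$. Statistics: $S=\Phi^{-1/2}Rb_0\,(b_0'\Omega b_0)^{-1/2}$ and $T=\Phi^{-1/2}R\,\Omega^{-1}a_0\,(a_0'\Omega^{-1}a_0)^{-1/2}$; $([S:T],\Omega_0,\Phi)$ is a one-to-one transformation of the data. Parameter functions: $c_\beta=(\beta-\beta_0)(b_0'\Omega b_0)^{-1/2}$, $d_\beta=a'\Omega^{-1}a_0\,(a_0'\Omega^{-1}a_0)^{-1/2}$, $\lambda=\mu'\Phi^{-1}\mu$. Groups: $\mathcal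 G_L(k)$ is the group of invertible $k\times k$ real matrices; $\mathcal G_T(2)$ is the group of invertible lower triangular $2\times2$ real matrices. $\mathrm{sgn}$ is the sign function. The action of $g_2$ alone is that of $g=(I_k,g_2)$. A function on a space with a group action is a maximal invariant if it is constant on orbits and takes different values on different orbits.
   Formalization: The parameter action is used only where Δg21+g22≠0; in (iv), false at μ=0 (Δ=0 and Δ≠0 share the value (0,0,0) on different orbits), maximality is shown for μ≠0 and, with μ=0 included, on the space of (c_βμ, d_βμ, Ω0, Φ); invariance holds on the whole parameter space. *)

theory Defs
  imports "HOL-Analysis.Analysis"
begin

section \<open>Group actions, orbits and maximal invariants\<close>

text \<open>
  The action of the pair \<open>(g1, g2)\<close> on the parameters involves a division by
  \<open>\<Delta> g21 + g22\<close>, which vanishes for some \<open>g2\<close>, so it is only partially defined.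
  An action is therefore given by a function \<open>act\<close> together with a predicate \<open>adm\<close>: \<open>adm g x\<close>
  says that \<open>g\<close> belongs to the group and that its action at \<open>x\<close> is defined.
  For the (total) action on the data, \<open>adm g x\<close> is just membership in the group.
\<close>

definition orbit_of :: "('g \<Rightarrow> 'x \<Rightarrow> bool) \<Rightarrow> ('g \<Rightarrow> 'x \<Rightarrow> 'x) \<Rightarrow> 'x \<Rightarrow> 'x set" where
  "orbit_of adm act x = {act g x | g. adm g x}"

definition invariant_on ::
  "'x set \<Rightarrow> ('g \<Rightarrow> 'x \<Rightarrow> bool) \<Rightarrow> ('g \<Rightarrow> 'x \<Rightarrow> 'x) \<Rightarrow> ('x \<Rightarrow> 'y) \<Rightarrow> bool" where
  "invariant_on X adm act f \<longleftrightarrow> (\<forall>x\<in>X. \<forall>y\<in>orbit_of adm act x. f y = f x)"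

definition maximal_invariant_on ::
  "'x set \<Rightarrow> ('g \<Rightarrow> 'x \<Rightarrow> bool) \<Rightarrow> ('g \<Rightarrow> 'x \<Rightarrow> 'x) \<Rightarrow> ('x \<Rightarrow> 'y) \<Rightarrow> bool" where
  "maximal_invariant_on X adm act f \<longleftrightarrow>
     invariant_on X adm act f \<and>
     (\<forall>x\<in>X. \<forall>y\<in>X. orbit_of adm act x \<noteq> orbit_of adm act y \<longrightarrow> f x \<noteq> f y)"

section \<open>Matrices\<close>

definition pos_def :: "real^'n^'n \<Rightarrow> bool" where
  "pos_def A \<longleftrightarrow> transpose A = A \<and> (\<forall>x. x \<noteq> 0 \<longrightarrow> x \<bullet> (A *v x) > 0)"

text \<open>The power \<open>-1/2\<close> of a positive definite matrix refers to its symmetric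
  positive definite square root.\<close>

definition mat_sqrt :: "real^'n^'n \<Rightarrow> real^'n^'n" where
  "mat_sqrt A = (THE C. pos_def C \<and> C ** C = A)"

definition inv_sqrt :: "real^'n^'n \<Rightarrow> real^'n^'n" where
  "inv_sqrt A = matrix_inv (mat_sqrt A)"

definition hcat :: "real^'k \<Rightarrow> real^'k \<Rightarrow> real^2^'k" where
  "hcat s t = (\<chi> i. vector [s $ i, t $ i])"

definition kron :: "real^'b^'a \<Rightarrow> real^'d^'c \<Rightarrow> real^('b \<times> 'd)^('a \<times> 'c)" where
  "kron A C = (\<chi> p q. A $ fst p $ fst q * C $ snd p $ snd q)"

section \<open>The Kronecker model\<close>

text \<open>
  Matrices with \<open>k\<close> rows and two columns have type \<open>real^2^'k\<close>.  A data point is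
  \<open>(R0, \<Omega>0, \<Phi>)\<close>; since \<open>vec(R0)\<close> has a nondegenerate normal law, \<open>R0\<close> ranges over all
  matrices.  A parameter point is \<open>(\<Delta>, \<mu>, \<Omega>0, \<Phi>)\<close>.
\<close>

type_synonym 'k data = "(real^2^'k) \<times> (real^2^2) \<times> (real^'k^'k)"
type_synonym 'k param = "real \<times> (real^'k) \<times> (real^2^2) \<times> (real^'k^'k)"
type_synonym 'k grp = "(real^'k^'k) \<times> (real^2^2)"

definition data_space :: "'k::finite data set" where
  "data_space = {(R0, \<Omega>0, \<Phi>). pos_def \<Omega>0 \<and> pos_def \<Phi>}"

definition param_space :: "'k::finite param set" where
  "param_space = {(\<Delta>, \<mu>, \<Omega>0, \<Phi>). pos_def \<Omega>0 \<and> pos_def \<Phi>}"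

definition B0 :: "real \<Rightarrow> real^2^2" where
  "B0 \<beta>0 = vector [vector [1, 0], vector [- \<beta>0, 1]]"

definition a_vec :: "real \<Rightarrow> real^2" where
  "a_vec \<beta> = vector [\<beta>, 1]"

definition b_vec :: "real \<Rightarrow> real^2" where
  "b_vec \<beta> = vector [1, - \<beta>]"

text \<open>The inverses of \<open>R \<mapsto> R0 = R B0\<close> and \<open>\<Omega> \<mapsto> \<Omega>0 = B0' \<Omega> B0\<close>.\<close>

definition orig_R :: "real \<Rightarrow> real^2^'k \<Rightarrow> real^2^'k" where
  "orig_R \<beta>0 R0 = R0 ** matrix_inv (B0 \<beta>0)"

definition orig_Omega :: "real \<Rightarrow> real^2^2 \<Rightarrow> real^2^2" where
  "orig_Omega \<beta>0 \<Omega>0 = transpose (matrix_inv (B0 \<beta>0)) ** \<Omega>0 ** matrix_inv (B0 \<beta>0)"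

subsection \<open>Statistics\<close>

definition stat_S :: "real \<Rightarrow> real^2^'k \<Rightarrow> real^2^2 \<Rightarrow> real^'k^'k \<Rightarrow> real^'k" where
  "stat_S \<beta>0 R \<Omega> \<Phi> =
     (1 / sqrt (b_vec \<beta>0 \<bullet> (\<Omega> *v b_vec \<beta>0))) *\<^sub>R (inv_sqrt \<Phi> *v (R *v b_vec \<beta>0))"

definition stat_T :: "real \<Rightarrow> real^2^'k \<Rightarrow> real^2^2 \<Rightarrow> real^'k^'k \<Rightarrow> real^'k" where
  "stat_T \<beta>0 R \<Omega> \<Phi> =
     (1 / sqrt (a_vec \<beta>0 \<bullet> (matrix_inv \<Omega> *v a_vec \<beta>0))) *\<^sub>R
       (inv_sqrt \<Phi> *v (R *v (matrix_inv \<Omega> *v a_vec \<beta>0)))"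

definition data_S :: "real \<Rightarrow> 'k::finite data \<Rightarrow> real^'k" where
  "data_S \<beta>0 = (\<lambda>(R0, \<Omega>0, \<Phi>). stat_S \<beta>0 (orig_R \<beta>0 R0) (orig_Omega \<beta>0 \<Omega>0) \<Phi>)"

definition data_T :: "real \<Rightarrow> 'k::finite data \<Rightarrow> real^'k" where
  "data_T \<beta>0 = (\<lambda>(R0, \<Omega>0, \<Phi>). stat_T \<beta>0 (orig_R \<beta>0 R0) (orig_Omega \<beta>0 \<Omega>0) \<Phi>)"

definition data_stats :: "real \<Rightarrow> 'k::finite data \<Rightarrow> 'k data" where
  "data_stats \<beta>0 = (\<lambda>(R0, \<Omega>0, \<Phi>).
     (hcat (data_S \<beta>0 (R0, \<Omega>0, \<Phi>)) (data_T \<beta>0 (R0, \<Omega>0, \<Phi>)), \<Omega>0, \<Phi>))"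

definition Q_S :: "real \<Rightarrow> 'k::finite data \<Rightarrow> real" where
  "Q_S \<beta>0 x = data_S \<beta>0 x \<bullet> data_S \<beta>0 x"

definition Q_T :: "real \<Rightarrow> 'k::finite data \<Rightarrow> real" where
  "Q_T \<beta>0 x = data_T \<beta>0 x \<bullet> data_T \<beta>0 x"

definition Q_ST :: "real \<Rightarrow> 'k::finite data \<Rightarrow> real" where
  "Q_ST \<beta>0 x = data_S \<beta>0 x \<bullet> data_T \<beta>0 x"

subsection \<open>Parameter functions\<close>

definition c_fun :: "real \<Rightarrow> real \<Rightarrow> real^2^2 \<Rightarrow> real" where
  "c_fun \<beta>0 \<beta> \<Omega> = (\<beta> - \<beta>0) / sqrt (b_vec \<beta>0 \<bullet> (\<Omega> *v b_vec \<beta>0))"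

definition d_fun :: "real \<Rightarrow> real \<Rightarrow> real^2^2 \<Rightarrow> real" where
  "d_fun \<beta>0 \<beta> \<Omega> = (a_vec \<beta> \<bullet> (matrix_inv \<Omega> *v a_vec \<beta>0)) /
     sqrt (a_vec \<beta>0 \<bullet> (matrix_inv \<Omega> *v a_vec \<beta>0))"

definition param_c :: "real \<Rightarrow> 'k::finite param \<Rightarrow> real" where
  "param_c \<beta>0 = (\<lambda>(\<Delta>, \<mu>, \<Omega>0, \<Phi>). c_fun \<beta>0 (\<beta>0 + \<Delta>) (orig_Omega \<beta>0 \<Omega>0))"

definition param_d :: "real \<Rightarrow> 'k::finite param \<Rightarrow> real" where
  "param_d \<beta>0 = (\<lambda>(\<Delta>, \<mu>, \<Omega>0, \<Phi>). d_fun \<beta>0 (\<beta>0 + \<Delta>) (orig_Omega \<beta>0 \<Omega>0))"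

definition param_lambda :: "'k::finite param \<Rightarrow> real" where
  "param_lambda = (\<lambda>(\<Delta>, \<mu>, \<Omega>0, \<Phi>). \<mu> \<bullet> (matrix_inv \<Phi> *v \<mu>))"

definition param_funs ::
  "real \<Rightarrow> 'k::finite param \<Rightarrow> (real^'k) \<times> (real^'k) \<times> (real^2^2) \<times> (real^'k^'k)" where
  "param_funs \<beta>0 = (\<lambda>(\<Delta>, \<mu>, \<Omega>0, \<Phi>).
     (param_c \<beta>0 (\<Delta>, \<mu>, \<Omega>0, \<Phi>) *\<^sub>R \<mu>, param_d \<beta>0 (\<Delta>, \<mu>, \<Omega>0, \<Phi>) *\<^sub>R \<mu>, \<Omega>0, \<Phi>))"

definition param_inv :: "real \<Rightarrow> 'k::finite param \<Rightarrow> real \<times> real \<times> real" where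
  "param_inv \<beta>0 p =
     ((param_c \<beta>0 p)\<^sup>2 * param_lambda p,
      (param_d \<beta>0 p)\<^sup>2 * param_lambda p,
      \<bar>param_c \<beta>0 p * param_d \<beta>0 p\<bar> * param_lambda p)"

subsection \<open>Groups and actions\<close>

definition GL :: "(real^'k^'k) set" where
  "GL = {g. invertible g}"

definition GT :: "(real^2^2) set" where
  "GT = {g. invertible g \<and> g $ 1 $ 2 = 0}"

definition act_data1 :: "real^'k^'k \<Rightarrow> 'k::finite data \<Rightarrow> 'k data" where
  "act_data1 g1 = (\<lambda>(R0, \<Omega>0, \<Phi>). (g1 ** R0, \<Omega>0, g1 ** \<Phi> ** transpose g1))"

definition act_data2 :: "real^2^2 \<Rightarrow> 'k::finite data \<Rightarrow> 'k data" where
  "act_data2 g2 = (\<lambda>(R0, \<Omega>0, \<Phi>). (R0 ** transpose g2, g2 ** \<Omega>0 ** transpose g2, \<Phi>))"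

text \<open>The two actions on the data commute, so the order of composition is immaterial.\<close>

definition act_data :: "'k grp \<Rightarrow> 'k::finite data \<Rightarrow> 'k data" where
  "act_data g = act_data1 (fst g) \<circ> act_data2 (snd g)"

definition adm_data :: "'k grp \<Rightarrow> 'k::finite data \<Rightarrow> bool" where
  "adm_data g x \<longleftrightarrow> g \<in> GL \<times> GT"

definition act_param :: "'k grp \<Rightarrow> 'k::finite param \<Rightarrow> 'k param" where
  "act_param = (\<lambda>(g1, g2) (\<Delta>, \<mu>, \<Omega>0, \<Phi>).
     (\<Delta> * g2 $ 1 $ 1 / (\<Delta> * g2 $ 2 $ 1 + g2 $ 2 $ 2),
      (\<Delta> * g2 $ 2 $ 1 + g2 $ 2 $ 2) *\<^sub>R (g1 *v \<mu>),
      g2 ** \<Omega>0 ** transpose g2,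
      g1 ** \<Phi> ** transpose g1))"

definition adm_param :: "'k grp \<Rightarrow> 'k::finite param \<Rightarrow> bool" where
  "adm_param = (\<lambda>(g1, g2) (\<Delta>, \<mu>, \<Omega>0, \<Phi>).
     g1 \<in> GL \<and> g2 \<in> GT \<and> \<Delta> * g2 $ 2 $ 1 + g2 $ 2 $ 2 \<noteq> 0)"

text \<open>
  The action of \<open>(g1, g2)\<close> on \<open>\<Omega>0\<close> and \<open>\<Phi>\<close> is the factorwise form of
  \<open>\<Sigma>0 \<mapsto> (g2 \<otimes> g1) \<Sigma>0 (g2' \<otimes> g1')\<close> with \<open>\<Sigma>0 = \<Omega>0 \<otimes> \<Phi>\<close>, and at \<open>g2 = I\<close>
  the action of \<open>g1\<close> alone is recovered.
\<close>

lemma kron_mult: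
  fixes A :: "real^'b^'a" and A' :: "real^'c^'b" and C :: "real^'e^'d" and C' :: "real^'f^'e"
  shows "kron A C ** kron A' C' = kron (A ** A') (C ** C')"
  by (simp add: kron_def matrix_matrix_mult_def vec_eq_iff sum_product sum.cartesian_product
      UNIV_Times_UNIV [symmetric] split_beta mult_ac del: UNIV_Times_UNIV)

lemma kron_action:
  "kron g2 g1 ** kron \<Omega>0 \<Phi> ** kron (transpose g2) (transpose g1) =
   kron (g2 ** \<Omega>0 ** transpose g2) (g1 ** \<Phi> ** transpose g1)"
  by (simp add: kron_mult)

lemma act_param_g1:
  "act_param (g1, mat 1) (\<Delta>, \<mu>, \<Omega>0, \<Phi>) = (\<Delta>, g1 *v \<mu>, \<Omega>0, g1 ** \<Phi> ** transpose g1)"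
  by (simp add: act_param_def mat_def [where k = "1::real"] transpose_mat [unfolded mat_def]
      matrix_mul_lid [unfolded mat_def] matrix_mul_rid [unfolded mat_def])

text \<open>
  The action on the space of parameter functions \<open>(c \<mu>, d \<mu>, \<Omega>0, \<Phi>)\<close>.  It is admissible when it
  does not leave the range of \<open>param_funs\<close>.  This space is needed for \<open>\<mu> = 0\<close>: such parameters
  all have \<open>param_inv = (0, 0, 0)\<close>, but those with \<open>\<Delta> = 0\<close> and \<open>\<Delta> \<noteq> 0\<close> lie on different orbits of
  \<open>act_param\<close>, whereas \<open>param_funs\<close> no longer depends on \<open>\<Delta>\<close> there.
\<close>

definition act_funs ::
  "'k grp \<Rightarrow> (real^'k) \<times> (real^'k) \<times> (real^2^2) \<times> (real^'k^'k)
     \<Rightarrow> (real^'k::finite) \<times> (real^'k) \<times> (real^2^2) \<times> (real^'k^'k)" where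
  "act_funs = (\<lambda>(g1, g2) (u, v, \<Omega>0, \<Phi>).
     (sgn (g2 $ 1 $ 1) *\<^sub>R (g1 *v u), sgn (g2 $ 2 $ 2) *\<^sub>R (g1 *v v),
      g2 ** \<Omega>0 ** transpose g2, g1 ** \<Phi> ** transpose g1))"

definition adm_funs ::
  "real \<Rightarrow> 'k grp \<Rightarrow> (real^'k::finite) \<times> (real^'k) \<times> (real^2^2) \<times> (real^'k^'k) \<Rightarrow> bool" where
  "adm_funs \<beta>0 g z \<longleftrightarrow> g \<in> GL \<times> GT \<and> act_funs g z \<in> param_funs \<beta>0 ` param_space"

end

theory Submission
  imports Defs
begin

text \<open>
  Up to the factor \<open>\<Phi>\<close> to the power \<open>-1/2\<close>, \<open>S\<close> and \<open>T\<close> are the columns of \<open>R0 (L')\<^sup>-\<^sup>1\<close>, where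
  \<open>\<Omega>0 = L L'\<close> with \<open>L\<close> lower triangular. Replacing \<open>\<Omega>0\<close> by \<open>g2 \<Omega>0 g2'\<close> replaces \<open>L\<close> by
  \<open>g2 L\<close> up to the signs of the diagonal of \<open>g2\<close>, so these columns only change sign. Conversely, if
  two data points have the same \<open>S'S\<close>, \<open>T'T\<close> and \<open>\<bar>S'T\<bar>\<close>, then after a sign change of \<open>T\<close> an
  orthogonal matrix maps one pair \<open>(S, T)\<close> to the other; square roots of the two \<open>\<Phi>\<close> turn it into
  \<open>g1\<close>, and \<open>g2\<close> exists because the triangular group is transitive on positive definite matrices.

  The parameter statements follow from those on the data, since \<open>(\<Delta>, \<mu>) \<mapsto> [\<Delta> \<mu> : \<mu>]\<close> is
  equivariant and takes \<open>c\<^sup>2 \<lambda>\<close>, \<open>d\<^sup>2 \<lambda>\<close>, \<open>\<bar>c d\<bar> \<lambda>\<close> to \<open>S'S\<close>, \<open>T'T\<close>, \<open>\<bar>S'T\<bar>\<close>.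
\<close>

section \<open>Square roots of positive definite matrices\<close>

text \<open>The eigenvector maximizes the Rayleigh quotient on the unit sphere of \<open>V\<close>.\<close>

lemma self_adjoint_eigenvector:
  fixes f :: "'a::euclidean_space \<Rightarrow> 'a"
  assumes lin: "linear f" and sym: "\<And>x y. x \<bullet> f y = f x \<bullet> y"
    and V: "subspace V" "f ` V \<subseteq> V" "V \<noteq> {0}"
  obtains x where "x \<in> V" "norm x = 1" "f x = (x \<bullet> f x) *\<^sub>R x"
proof -
  let ?K = "V \<inter> sphere 0 1"
  obtain v where v: "v \<in> V" "v \<noteq> 0"
    using V subspace_0 by blast
  then have "(1 / norm v) *\<^sub>R v \<in> ?K"
    using V(1) by (simp add: subspace_scale)
  then have "?K \<noteq> {}" by blast
  moreover have "compact ?K"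
    using closed_subspace[OF V(1)] compact_sphere by (simp add: closed_Int_compact)
  moreover have "continuous_on ?K (\<lambda>x. x \<bullet> f x)"
    using lin by (intro continuous_intros linear_continuous_on) (simp add: linear_linear)
  ultimately obtain x where x: "x \<in> ?K" and max: "\<And>y. y \<in> ?K \<Longrightarrow> y \<bullet> f y \<le> x \<bullet> f x"
    using continuous_attains_sup by metis
  define m where "m = x \<bullet> f x"
  have rayleigh: "y \<bullet> f y \<le> m * (y \<bullet> y)" if "y \<in> V" for y
  proof (cases "y = 0")
    case True
    then show ?thesis by simp
  next
    case False
    let ?z = "(1 / norm y) *\<^sub>R y"
    have "?z \<in> ?K" using that False V(1) by (simp add: subspace_scale)
    then have "?z \<bullet> f ?z \<le> m" unfolding m_def by (rule max)
    then have "(y \<bullet> f y) / (norm y)\<^sup>2 \<le> m"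
      by (simp add: linear_cmul[OF lin] power2_eq_square)
    then show ?thesis
      using False by (simp add: divide_le_eq power2_norm_eq_inner)
  qed
  \<comment> \<open>The residual \<open>w\<close> is orthogonal to \<open>x\<close>, and the aim is
    \<open>w = 0\<close>. Inserting \<open>x + t *\<^sub>R w\<close> in the Rayleigh inequality
    leaves a quadratic in \<open>t\<close> without constant term, with coefficients
    \<open>2 * a\<close> and \<open>b\<close>.\<close>
  define w where "w = m *\<^sub>R x - f x"
  define a where "a = w \<bullet> w"
  define b where "b = m * (w \<bullet> w) - w \<bullet> f w"
  have xV: "x \<in> V" and nx: "norm x = 1" using x by auto
  have wV: "w \<in> V"
    unfolding w_def using V xV by (intro subspace_diff subspace_scale) auto
  have quad: "0 \<le> 2 * t * a + t\<^sup>2 * b" for t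
  proof -
    have "x + t *\<^sub>R w \<in> V"
      using V(1) xV wV by (intro subspace_add subspace_scale)
    then have "0 \<le> m * ((x + t *\<^sub>R w) \<bullet> (x + t *\<^sub>R w)) - (x + t *\<^sub>R w) \<bullet> f (x + t *\<^sub>R w)"
      using rayleigh by force
    also have "\<dots> = m * (x \<bullet> x) - x \<bullet> f x + 2 * t * (m * (x \<bullet> w) - f x \<bullet> w) + t\<^sup>2 * b"
      using sym[of x w]
      by (simp add: b_def linear_add[OF lin] linear_cmul[OF lin] inner_add inner_commute
          algebra_simps power2_eq_square)
    also have "m * (x \<bullet> x) - x \<bullet> f x = 0"
      using nx by (simp add: m_def norm_eq_1)
    also have "m * (x \<bullet> w) - f x \<bullet> w = a"
      by (simp add: a_def w_def inner_diff_left)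
    finally show ?thesis by simp
  qed
  have b0: "b \<ge> 0" using rayleigh[OF wV] by (simp add: b_def)
  \<comment> \<open>A small negative \<open>t\<close> lets the linear term dominate. The denominator
    is \<open>b + 1\<close> because \<open>b\<close> may vanish.\<close>
  have "0 \<le> 2 * (- a / (b + 1)) * a + (- a / (b + 1))\<^sup>2 * b" by (rule quad)
  also have "\<dots> = - (a\<^sup>2 * (b + 2) / (b + 1)\<^sup>2)"
    using b0 by (simp add: divide_simps power2_eq_square) (simp add: algebra_simps)
  finally have "a\<^sup>2 * (b + 2) / (b + 1)\<^sup>2 \<le> 0" by simp
  then have "a = 0"
    using b0 by (simp add: divide_le_0_iff mult_le_0_iff)
  then have "f x = m *\<^sub>R x" by (simp add: a_def w_def)
  with that xV nx show thesis by (simp add: m_def)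
qed

text \<open>Induction on the dimension: split off a unit eigenvector \<open>x\<close>.
  Self-adjointness makes the orthogonal complement of \<open>x\<close> in \<open>V\<close> invariant
  again, which is why the claim is stated for invariant subspaces.\<close>

lemma self_adjoint_eigenbasis_subspace:
  fixes f :: "'a::euclidean_space \<Rightarrow> 'a"
  assumes lin: "linear f" and sym: "\<And>x y. x \<bullet> f y = f x \<bullet> y"
    and "subspace V" "f ` V \<subseteq> V"
  shows "\<exists>B. pairwise orthogonal B \<and> span B = V \<and> (\<forall>b\<in>B. norm b = 1 \<and> f b = (b \<bullet> f b) *\<^sub>R b)"
  using assms(3,4)
proof (induction "dim V" arbitrary: V rule: less_induct)
  case less
  show ?case
  proof (cases "V = {0}")
    case True
    then show ?thesis by (intro exI[of _ "{}"]) simp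
  next
    case False
    obtain x where x: "x \<in> V" "norm x = 1" "f x = (x \<bullet> f x) *\<^sub>R x"
      using self_adjoint_eigenvector[OF lin sym less.prems False] by metis
    define W where "W = {v \<in> V. x \<bullet> v = 0}"
    have W: "subspace W"
      using less.prems(1) by (auto simp: W_def subspace_def inner_add_right)
    have "x \<bullet> f v = 0" if "x \<bullet> v = 0" for v
      using that sym[of x v] x(3) by (metis inner_scaleR_left mult_zero_right)
    then have fW: "f ` W \<subseteq> W"
      using less.prems(2) by (auto simp: W_def)
    have "x \<bullet> x = 1" using x(2) by (simp add: norm_eq_1)
    then have "x \<notin> W" by (simp add: W_def)
    then have "W \<noteq> V" using x(1) by blast
    then have "W \<subset> V" by (auto simp: W_def)
    then have "dim W < dim V"
      using W less.prems(1) by (metis dim_psubset span_eq_iff)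
    from less.hyps[OF this W fW] obtain B where
      B: "pairwise orthogonal B" "span B = W" "\<forall>b\<in>B. norm b = 1 \<and> f b = (b \<bullet> f b) *\<^sub>R b"
      by blast
    have BW: "B \<subseteq> W" using B(2) span_superset by blast
    have "pairwise orthogonal (insert x B)"
      using B(1) BW by (auto simp: pairwise_insert W_def orthogonal_def inner_commute)
    moreover have "span (insert x B) = V"
    proof
      show "span (insert x B) \<subseteq> V"
        using BW x(1) less.prems(1) by (intro span_minimal) (auto simp: W_def)
      show "V \<subseteq> span (insert x B)"
      proof
        fix v assume "v \<in> V"
        then have "v - (x \<bullet> v) *\<^sub>R x \<in> W"
          using x(1) less.prems(1) \<open>x \<bullet> x = 1\<close>
          by (simp add: W_def subspace_diff subspace_scale inner_diff_right)
        then show "v \<in> span (insert x B)"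
          using B(2) span_breakdown_eq by blast
      qed
    qed
    ultimately show ?thesis
      using B(3) x by (intro exI[of _ "insert x B"]) auto
  qed
qed

lemma self_adjoint_eigenbasis:
  fixes f :: "'a::euclidean_space \<Rightarrow> 'a"
  assumes "linear f" "\<And>x y. x \<bullet> f y = f x \<bullet> y"
  obtains B where "pairwise orthogonal B" "span B = UNIV"
    "\<And>b. b \<in> B \<Longrightarrow> norm b = 1" "\<And>b. b \<in> B \<Longrightarrow> f b = (b \<bullet> f b) *\<^sub>R b"
  using self_adjoint_eigenbasis_subspace[OF assms, of UNIV] by auto

lemma pos_def_self_adjoint: "pos_def A \<Longrightarrow> x \<bullet> (A *v y) = (A *v x) \<bullet> y"
  by (metis dot_lmul_matrix pos_def_def transpose_matrix_vector)

lemma inner_transpose: "(A *v x) \<bullet> y = x \<bullet> (transpose A *v y)" for A :: "real^'n^'m"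
  by (metis dot_lmul_matrix inner_commute transpose_matrix_vector transpose_transpose)

text \<open>Replace each eigenvalue by its square root in an orthonormal eigenbasis.\<close>

lemma pos_def_square_root_exists:
  fixes A :: "real^'n^'n"
  assumes A: "pos_def A"
  shows "\<exists>C. pos_def C \<and> C ** C = A"
proof -
  let ?f = "(*v) A"
  obtain B where B: "pairwise orthogonal B" "span B = UNIV" "\<And>b. b \<in> B \<Longrightarrow> norm b = 1"
    and eig: "\<And>b. b \<in> B \<Longrightarrow> A *v b = (b \<bullet> (A *v b)) *\<^sub>R b"
    using self_adjoint_eigenbasis[of ?f] pos_def_self_adjoint[OF A] matrix_vector_mul_linear
    by metis
  have "0 \<notin> B" using B(3) by force
  then have fin: "finite B"
    using B(1) pairwise_orthogonal_independent independent_imp_finite by blast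
  \<comment> \<open>For a unit eigenvector \<open>b\<close>, the number under the root is its
    eigenvalue.\<close>
  define r where "r b = sqrt (b \<bullet> (A *v b))" for b
  have rpos: "r b > 0" if "b \<in> B" for b
    using A \<open>0 \<notin> B\<close> that by (metis pos_def_def r_def real_sqrt_gt_0_iff)
  define h where "h x = (\<Sum>b\<in>B. (r b * (b \<bullet> x)) *\<^sub>R b)" for x
  have linh: "linear h"
    by (rule linearI)
      (simp_all add: h_def inner_add_right distrib_left scaleR_add_left sum.distrib
        scaleR_sum_right mult.left_commute)
  have hb: "h b = r b *\<^sub>R b" if "b \<in> B" for b
  proof -
    have "h b = (\<Sum>c\<in>B. if c = b then r b *\<^sub>R b else 0)"
      unfolding h_def using B(1) B(3)[OF that] that
      by (intro sum.cong) (auto simp: pairwise_def orthogonal_def norm_eq_1)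
    then show ?thesis using fin that by simp
  qed
  have hh: "h (h x) = A *v x" for x
  proof -
    have "(h \<circ> h) x = A *v x"
    proof (rule linear_eq_on_span[where B = B and f = "h \<circ> h" and g = ?f])
      show "linear (h \<circ> h)" by (rule linear_compose[OF linh linh])
      show "linear ?f" by simp
      show "x \<in> span B" using B(2) by simp
      show "(h \<circ> h) b = A *v b" if "b \<in> B" for b
      proof -
        have "(h \<circ> h) b = (r b)\<^sup>2 *\<^sub>R b"
          using hb[OF that] by (simp add: linear_cmul[OF linh] power2_eq_square)
        also have "(r b)\<^sup>2 = b \<bullet> (A *v b)"
          using rpos[OF that] by (simp add: r_def)
        finally show ?thesis using eig[OF that] by simp
      qed
    qed
    then show ?thesis by simp
  qed
  have symh: "x \<bullet> h y = h x \<bullet> y" for x y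
  proof -
    have "x \<bullet> h y = (\<Sum>b\<in>B. r b * (b \<bullet> y) * (x \<bullet> b))"
      by (simp add: h_def inner_sum_right)
    also have "\<dots> = (\<Sum>b\<in>B. r b * (b \<bullet> x) * (b \<bullet> y))"
      using inner_commute[of x] by (intro sum.cong) auto
    also have "\<dots> = h x \<bullet> y"
      by (simp add: h_def inner_sum_left)
    finally show ?thesis .
  qed
  have posh: "x \<bullet> h x > 0" if "x \<noteq> 0" for x
  proof -
    have eq: "x \<bullet> h x = (\<Sum>b\<in>B. r b * (b \<bullet> x)\<^sup>2)"
      by (simp add: h_def inner_sum_right inner_commute[of x] power2_eq_square mult.assoc)
    have "\<exists>b\<in>B. b \<bullet> x \<noteq> 0"
    proof (rule ccontr)
      assume "\<not> ?thesis"
      then have "orthogonal x b" if "b \<in> B" for b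
        using that inner_commute[of x b] by (auto simp: orthogonal_def)
      moreover have "x \<in> span B" using B(2) by simp
      ultimately have "orthogonal x x" by (rule orthogonal_to_span[rotated])
      with that show False by (simp add: orthogonal_def)
    qed
    then obtain b where "b \<in> B" "b \<bullet> x \<noteq> 0" by blast
    then have "0 < (\<Sum>b\<in>B. r b * (b \<bullet> x)\<^sup>2)"
      using fin rpos by (intro sum_pos2[where i = b]) (auto simp: less_imp_le)
    then show ?thesis using eq by simp
  qed
  let ?C = "matrix h"
  have C: "?C *v x = h x" for x using linh by (simp add: matrix_works)
  have "transpose ?C = ?C"
  proof -
    have "transpose ?C *v x = ?C *v x" for x
      by (rule vector_eq_rdot[THEN iffD1])
        (metis C inner_commute inner_transpose symh)
    then show ?thesis by (simp add: matrix_eq)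
  qed
  moreover have "?C ** ?C = A"
    by (simp add: matrix_eq C hh flip: matrix_vector_mul_assoc)
  ultimately show ?thesis
    using posh C by (auto simp: pos_def_def)
qed

text \<open>On an eigenvector \<open>b\<close> of \<open>C\<close> with eigenvalue \<open>c\<close>, \<open>(D + c) (D - c) b = 0\<close>, and \<open>D + c\<close> is
  injective.\<close>

lemma pos_def_square_root_unique:
  fixes C D :: "real^'n^'n"
  assumes C: "pos_def C" and D: "pos_def D" and eq: "C ** C = D ** D"
  shows "C = D"
proof -
  obtain B where B: "span B = UNIV" "\<And>b. b \<in> B \<Longrightarrow> norm b = 1"
    and eig: "\<And>b. b \<in> B \<Longrightarrow> C *v b = (b \<bullet> (C *v b)) *\<^sub>R b"
    using self_adjoint_eigenbasis[of "(*v) C"] pos_def_self_adjoint[OF C] matrix_vector_mul_linear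
    by metis
  have "C *v b = D *v b" if b: "b \<in> B" for b
  proof -
    define c where "c = b \<bullet> (C *v b)"
    define w where "w = D *v b - c *\<^sub>R b"
    have Cb: "C *v b = c *\<^sub>R b" using eig[OF b] by (simp add: c_def)
    have "b \<noteq> 0" using B(2)[OF b] by force
    then have c: "c > 0" using C by (simp add: c_def pos_def_def)
    have "D *v (D *v b) = C *v (C *v b)" by (simp add: matrix_vector_mul_assoc eq)
    also have "\<dots> = (c * c) *\<^sub>R b" by (simp add: Cb matrix_vector_mult_scaleR)
    finally have "D *v w + c *\<^sub>R w = 0"
      by (simp add: w_def matrix_vector_mult_diff_distrib matrix_vector_mult_scaleR scaleR_diff_right)
    then have "w \<bullet> (D *v w) + c * (w \<bullet> w) = 0"
      by (metis inner_add_right inner_scaleR_right inner_zero_right)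
    moreover have "w \<bullet> (D *v w) > 0" if "w \<noteq> 0" using D that by (simp add: pos_def_def)
    moreover have "c * (w \<bullet> w) \<ge> 0" using c by simp
    ultimately have "w = 0" by fastforce
    then show ?thesis by (simp add: Cb w_def)
  qed
  then have "C *v x = D *v x" for x
    using linear_eq_on_span[of "(*v) C" "(*v) D" B x] B(1) by simp
  then show ?thesis by (simp add: matrix_eq)
qed

lemma mat_sqrt:
  assumes "pos_def A"
  shows "pos_def (mat_sqrt A)" "mat_sqrt A ** mat_sqrt A = A"
proof -
  have "\<exists>!C. pos_def C \<and> C ** C = A"
    using pos_def_square_root_exists[OF assms] pos_def_square_root_unique by metis
  from theI'[OF this] show "pos_def (mat_sqrt A)" "mat_sqrt A ** mat_sqrt A = A"
    by (simp_all add: mat_sqrt_def)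
qed

section \<open>Inverses, congruences and orthogonal maps\<close>

lemma matrix_inv_mult:
  fixes A :: "real^'n^'n"
  assumes "invertible A"
  shows "A ** matrix_inv A = mat 1" "matrix_inv A ** A = mat 1"
proof -
  have "A ** matrix_inv A = mat 1 \<and> matrix_inv A ** A = mat 1"
    using assms unfolding invertible_def matrix_inv_def by (rule someI_ex)
  then show "A ** matrix_inv A = mat 1" "matrix_inv A ** A = mat 1" by simp_all
qed

lemma matrix_inv_vector:
  fixes A :: "real^'n^'n"
  assumes "invertible A"
  shows "A *v (matrix_inv A *v x) = x" "matrix_inv A *v (A *v x) = x"
  by (simp_all add: matrix_vector_mul_assoc matrix_inv_mult[OF assms])

lemma invertible_right_inverseI: "A ** B = mat 1 \<Longrightarrow> invertible A" for A :: "real^'n^'n"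
  by (auto simp: invertible_right_inverse)

lemma matrix_inv_unique:
  fixes A B :: "real^'n^'n"
  assumes "A ** B = mat 1"
  shows "matrix_inv A = B"
proof -
  note A = matrix_inv_mult[OF invertible_right_inverseI[OF assms]]
  have "matrix_inv A = matrix_inv A ** (A ** B)" by (simp add: assms)
  also have "\<dots> = B" by (simp add: matrix_mul_assoc A)
  finally show ?thesis .
qed

lemma invertible_matrix_inv: "invertible A \<Longrightarrow> invertible (matrix_inv A)" for A :: "real^'n^'n"
  using matrix_inv_mult invertible_right_inverseI by metis

lemma pos_def_invertible: "pos_def A \<Longrightarrow> invertible A"
  unfolding invertible_left_inverse matrix_left_invertible_ker
  by (metis inner_zero_right less_irrefl pos_def_def)

lemma pos_def_congruence:
  fixes A g :: "real^'n^'n"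
  assumes A: "pos_def A" and g: "invertible g"
  shows "pos_def (g ** A ** transpose g)"
  unfolding pos_def_def
proof (intro conjI allI impI)
  show "transpose (g ** A ** transpose g) = g ** A ** transpose g"
    using A by (simp add: pos_def_def matrix_transpose_mul matrix_mul_assoc)
  fix x :: "real^'n" assume "x \<noteq> 0"
  have "transpose g *v x \<noteq> 0"
  proof
    assume "transpose g *v x = 0"
    then have "x = 0"
      using matrix_inv_vector(2)[OF transpose_invertible[OF g], of x]
      by (simp del: transpose_matrix_vector)
    with \<open>x \<noteq> 0\<close> show False ..
  qed
  then have "0 < (transpose g *v x) \<bullet> (A *v (transpose g *v x))"
    using A by (simp add: pos_def_def)
  also have "\<dots> = x \<bullet> (g ** A ** transpose g *v x)"
    by (simp add: inner_transpose del: transpose_matrix_vector flip: matrix_vector_mul_assoc)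
  finally show "0 < x \<bullet> (g ** A ** transpose g *v x)" .
qed

text \<open>The inverse of \<open>g A g'\<close> is \<open>(g')^-1 A^-1 g^-1\<close>, so both
  factors \<open>g\<close> cancel. This is the source of the invariance under
  \<open>g1\<close>.\<close>

lemma inner_inv_congruence:
  fixes A g :: "real^'n^'n"
  assumes A: "invertible A" and g: "invertible g"
  shows "(g *v u) \<bullet> (matrix_inv (g ** A ** transpose g) *v (g *v v)) = u \<bullet> (matrix_inv A *v v)"
proof -
  let ?w = "matrix_inv (transpose g) *v (matrix_inv A *v v)"
  note g' = transpose_invertible[OF g]
  have "(g ** A ** transpose g) *v ?w = g *v v"
    by (simp add: matrix_inv_vector[OF A] matrix_inv_vector[OF g'] del: transpose_matrix_vector
        flip: matrix_vector_mul_assoc)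
  moreover have "invertible (g ** A ** transpose g)"
    using A g g' by (simp add: invertible_mult)
  ultimately have "matrix_inv (g ** A ** transpose g) *v (g *v v) = ?w"
    using matrix_inv_vector(2) by metis
  then show ?thesis
    by (simp add: inner_transpose matrix_inv_vector[OF g'] del: transpose_matrix_vector)
qed

lemma inv_sqrt:
  assumes "pos_def A"
  shows "mat_sqrt A *v (inv_sqrt A *v x) = x" "inv_sqrt A *v (mat_sqrt A *v x) = x"
    "mat_sqrt A ** inv_sqrt A = mat 1" "inv_sqrt A ** mat_sqrt A = mat 1"
    "invertible (inv_sqrt A)" "invertible (mat_sqrt A)"
  using matrix_inv_vector[of "mat_sqrt A"] matrix_inv_mult[of "mat_sqrt A"]
    pos_def_invertible[OF mat_sqrt(1)[OF assms]] invertible_matrix_inv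
  by (auto simp: inv_sqrt_def)

text \<open>Applying \<open>inv_sqrt A\<close> twice inverts \<open>A\<close>, and the self-adjoint
  \<open>mat_sqrt A\<close> moves the factor across. Square roots thereby disappear from all the
  inner products of \<open>S\<close> and \<open>T\<close>.\<close>

lemma inner_inv_sqrt:
  assumes A: "pos_def A"
  shows "(inv_sqrt A *v u) \<bullet> (inv_sqrt A *v v) = u \<bullet> (matrix_inv A *v v)"
proof -
  have "A *v (inv_sqrt A *v (inv_sqrt A *v v)) = v"
    using mat_sqrt(2)[OF A] inv_sqrt(1)[OF A] by (metis matrix_vector_mul_assoc)
  then have v: "inv_sqrt A *v (inv_sqrt A *v v) = matrix_inv A *v v"
    using matrix_inv_vector(2)[OF pos_def_invertible[OF A]] by metis
  have "(inv_sqrt A *v u) \<bullet> (inv_sqrt A *v v)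
    = (inv_sqrt A *v u) \<bullet> (mat_sqrt A *v (inv_sqrt A *v (inv_sqrt A *v v)))"
    by (simp add: inv_sqrt(1)[OF A])
  also have "\<dots> = (mat_sqrt A *v (inv_sqrt A *v u)) \<bullet> (inv_sqrt A *v (inv_sqrt A *v v))"
    by (rule pos_def_self_adjoint[OF mat_sqrt(1)[OF A]])
  finally show ?thesis by (simp add: inv_sqrt(1)[OF A] v)
qed

text \<open>Map \<open>s\<close> to \<open>s'\<close> first; the images of \<open>t\<close> and \<open>t'\<close> then have the same inner product
  with \<open>s'\<close>, so the reflection exchanging them fixes \<open>s'\<close>.\<close>

lemma orthogonal_matrix_pair_exists:
  fixes s t s' t' :: "real^'n"
  assumes "s \<bullet> s = s' \<bullet> s'" "t \<bullet> t = t' \<bullet> t'" "s \<bullet> t = s' \<bullet> t'"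
  obtains M where "orthogonal_matrix M" "M *v s = s'" "M *v t = t'"
proof -
  obtain f where f: "orthogonal_transformation f" "f s = s'"
    using orthogonal_transformation_exists[of s s'] assms(1) by (metis norm_eq)
  define u where "u = f t - t'"
  \<comment> \<open>\<open>r\<close> is the reflection in the hyperplane orthogonal to
    \<open>u\<close>. For \<open>u = 0\<close>, division by zero gives \<open>k = 0\<close>, and
    \<open>r\<close> is the identity, as desired.\<close>
  define k where "k = 2 / (u \<bullet> u)"
  define r where "r x = x - (k * (u \<bullet> x)) *\<^sub>R u" for x
  have k: "k * k * (u \<bullet> u) = 2 * k"
    by (cases "u = 0") (simp_all add: k_def)
  have "linear r"
    by (rule linearI) (simp_all add: r_def inner_add_right algebra_simps)
  moreover have "r x \<bullet> r y = x \<bullet> y" for x y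
  proof -
    have "r x \<bullet> r y = x \<bullet> y - 2 * k * (u \<bullet> x) * (u \<bullet> y) + (k * k * (u \<bullet> u)) * (u \<bullet> x) * (u \<bullet> y)"
      by (simp only: r_def inner_diff_left inner_diff_right inner_scaleR_left inner_scaleR_right
          inner_commute[of x u]) (simp add: algebra_simps)
    then show ?thesis by (simp add: k)
  qed
  ultimately have r: "orthogonal_transformation r"
    by (simp add: orthogonal_transformation_def)
  have ft: "f t \<bullet> f t = t' \<bullet> t'" and fst: "s' \<bullet> f t = s' \<bullet> t'"
    using f assms by (metis orthogonal_transformation_def)+
  have "s' \<bullet> u = 0"
    using fst by (simp add: u_def inner_diff_right)
  then have "u \<bullet> s' = 0" by (simp only: inner_commute)
  then have rs: "r s' = s'" by (simp add: r_def)
  \<comment> \<open>Equality of the norms of \<open>f t\<close> and \<open>t'\<close> makes the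
    reflection subtract exactly \<open>u\<close> from \<open>f t\<close>.\<close>
  have "2 * (u \<bullet> f t) = u \<bullet> u"
    using ft by (simp add: u_def inner_diff_left inner_diff_right inner_commute)
  then have rt: "r (f t) = t'"
    by (cases "u = 0") (simp_all add: r_def k_def, simp_all add: u_def)
  have "orthogonal_transformation (r \<circ> f)"
    using r f(1) by (rule orthogonal_transformation_compose)
  then have "linear (r \<circ> f)" "orthogonal_matrix (matrix (r \<circ> f))"
    by (simp_all add: orthogonal_transformation_matrix)
  moreover have "matrix (r \<circ> f) *v s = s'" "matrix (r \<circ> f) *v t = t'"
    using \<open>linear (r \<circ> f)\<close> f(2) rs rt by (simp_all add: matrix_works)
  ultimately show thesis using that by blast
qed

section \<open>Two by two matrices\<close>

lemmas matrix2_simps = vec_eq_iff forall_2 sum_2 inner_vec_def matrix_matrix_mult_def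
  matrix_vector_mult_def transpose_def mat_def

lemma pos_def_2:
  fixes A :: "real^2^2"
  assumes "pos_def A"
  shows "A $ 2 $ 1 = A $ 1 $ 2" "A $ 1 $ 1 > 0" "det A > 0"
proof -
  have pos: "x \<bullet> (A *v x) > 0" if "x \<noteq> 0" for x using assms that by (simp add: pos_def_def)
  have "transpose A $ 1 $ 2 = A $ 1 $ 2" using assms by (simp add: pos_def_def)
  then show sym: "A $ 2 $ 1 = A $ 1 $ 2" by (simp add: transpose_def)
  have "axis 1 1 \<noteq> (0 :: real^2)" by (simp add: axis_eq_0_iff)
  from pos[OF this] show A11: "A $ 1 $ 1 > 0"
    by (simp add: matrix2_simps axis_def)
  \<comment> \<open>At this vector the quadratic form equals \<open>A $ 1 $ 1\<close> times the
    determinant.\<close>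
  have "vector [- A $ 1 $ 2, A $ 1 $ 1] \<noteq> (0 :: real^2)"
    using A11 by (simp add: vec_eq_iff forall_2)
  from pos[OF this] have "A $ 1 $ 1 * det A > 0"
    by (simp add: matrix2_simps det_2 sym algebra_simps)
  with A11 show "det A > 0" by (simp add: zero_less_mult_iff)
qed

lemma matrix_inv_2:
  fixes A :: "real^2^2"
  assumes "det A \<noteq> 0"
  shows "matrix_inv A = (1 / det A) *\<^sub>R
    vector [vector [A $ 2 $ 2, - A $ 1 $ 2], vector [- A $ 2 $ 1, A $ 1 $ 1]]"
proof (rule matrix_inv_unique)
  let ?B = "vector [vector [A $ 2 $ 2, - A $ 1 $ 2], vector [- A $ 2 $ 1, A $ 1 $ 1]] :: real^2^2"
  have "A ** ?B = det A *\<^sub>R mat 1"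
    by (simp add: matrix2_simps det_2)
  then show "A ** ((1 / det A) *\<^sub>R ?B) = mat 1"
    using assms by (simp add: matrix_scalar_ac scalar_matrix_assoc[symmetric] matrix_mul_assoc)
qed

lemma GT_iff: "g \<in> GT \<longleftrightarrow> g $ 1 $ 2 = 0 \<and> g $ 1 $ 1 \<noteq> 0 \<and> g $ 2 $ 2 \<noteq> 0"
  by (auto simp: GT_def invertible_det_nz det_2)

lemma GT_mult: "g \<in> GT \<Longrightarrow> h \<in> GT \<Longrightarrow> g ** h \<in> GT"
  by (simp add: GT_iff matrix_matrix_mult_def sum_2)

lemma GT_matrix_inv:
  assumes "g \<in> GT"
  shows "matrix_inv g \<in> GT"
proof -
  have "det g \<noteq> 0" using assms by (simp add: GT_iff det_2)
  then show ?thesis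
    using assms by (simp add: GT_iff matrix_inv_2)
qed

text \<open>\<open>GT\<close> acts transitively on the positive definite matrices: solve for \<open>g\<close> entry by entry,
  starting with \<open>(g A g')\<^sub>1\<^sub>1\<close> and the determinant.\<close>

lemma GT_congruence_exists:
  fixes A B :: "real^2^2" and e :: real
  assumes A: "pos_def A" and B: "pos_def B" and e: "e\<^sup>2 = 1"
  obtains g where "g \<in> GT" "g ** A ** transpose g = B" "sgn (g $ 1 $ 1) = 1" "sgn (g $ 2 $ 2) = e"
proof -
  note A2 = pos_def_2[OF A] and B2 = pos_def_2[OF B]
  define p where "p = sqrt (B $ 1 $ 1 / A $ 1 $ 1)"
  \<comment> \<open>The determinant fixes the second diagonal entry only up to sign. The sign
    \<open>e\<close> is left free so that \<open>T\<close> can be flipped later; \<open>r\<close>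
    then solves the off-diagonal equation.\<close>
  define q where "q = sqrt (det B * A $ 1 $ 1 / (B $ 1 $ 1 * det A))"
  define r where "r = (B $ 1 $ 2 / p - e * q * A $ 1 $ 2) / A $ 1 $ 1"
  have pq: "p > 0" "q > 0" using A2 B2 by (simp_all add: p_def q_def)
  have p2: "p\<^sup>2 * A $ 1 $ 1 = B $ 1 $ 1" using A2 B2 by (simp add: p_def)
  have q2: "q\<^sup>2 * (B $ 1 $ 1 * det A) = det B * A $ 1 $ 1" using A2 B2 by (simp add: q_def)
  have r: "p * (r * A $ 1 $ 1 + e * q * A $ 1 $ 2) = B $ 1 $ 2"
    using A2 pq by (simp add: r_def field_simps)
  let ?g = "vector [vector [p, 0], vector [r, e * q]] :: real^2^2"
  have e1: "e = 1 \<or> e = -1" using e by (simp add: power2_eq_1_iff)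
  \<comment> \<open>\<open>?X\<close> is the lower right entry of the congruence. The determinants
    and the other entries already agree, so this entry is forced; multiplying by positive factors
    keeps the identity polynomial.\<close>
  let ?X = "r * (r * A $ 1 $ 1 + e * q * A $ 1 $ 2) + e * q * (r * A $ 1 $ 2 + e * q * A $ 2 $ 2)"
  have "B $ 1 $ 1 * A $ 1 $ 1 * ?X
      = A $ 1 $ 1 * (p * (r * A $ 1 $ 1 + e * q * A $ 1 $ 2))\<^sup>2 + q\<^sup>2 * (B $ 1 $ 1 * det A)"
    unfolding p2[symmetric] det_2 A2(1) using e by algebra
  also have "\<dots> = A $ 1 $ 1 * (B $ 1 $ 1 * B $ 2 $ 2)"
    unfolding r q2 by (simp add: det_2 B2(1) algebra_simps power2_eq_square)
  finally have X: "?X = B $ 2 $ 2" using A2 B2 by simp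
  have "?g ** A ** transpose ?g = B"
    using p2 r X by (simp add: matrix2_simps A2(1) B2(1) power2_eq_square algebra_simps)
  then show thesis
    using that[of ?g] pq e1 by (auto simp: GT_iff sgn_mult)
qed

section \<open>Standardized coordinates\<close>

text \<open>With the Cholesky factorization \<open>\<Omega>0 = L L'\<close>, the first two components are the columns of
  \<open>R0 (L')\<^sup>-\<^sup>1\<close>, that is, \<open>S\<close> and \<open>T\<close> without the factor \<open>\<Phi>\<close> to the power \<open>-1/2\<close>.\<close>

definition std_coords ::
  "'k::finite data \<Rightarrow> (real^'k) \<times> (real^'k) \<times> (real^2^2) \<times> (real^'k^'k)" where
  "std_coords = (\<lambda>(R0, \<Omega>0, \<Phi>).
     ((1 / sqrt (\<Omega>0 $ 1 $ 1)) *\<^sub>R column 1 R0,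
      (1 / sqrt (\<Omega>0 $ 1 $ 1 * det \<Omega>0)) *\<^sub>R
        (\<Omega>0 $ 1 $ 1 *\<^sub>R column 2 R0 - \<Omega>0 $ 1 $ 2 *\<^sub>R column 1 R0),
      \<Omega>0, \<Phi>))"

definition coords_inv ::
  "(real^'k) \<times> (real^'k) \<times> (real^2^2) \<times> (real^'k^'k) \<Rightarrow> real \<times> real \<times> real" where
  "coords_inv = (\<lambda>(u, v, \<Omega>0, \<Phi>).
     (u \<bullet> (matrix_inv \<Phi> *v u), v \<bullet> (matrix_inv \<Phi> *v v), \<bar>u \<bullet> (matrix_inv \<Phi> *v v)\<bar>))"

text \<open>The mean of \<open>R0\<close>; it carries the action on the parameters to the action on the data.\<close>

definition mean_data :: "'k::finite param \<Rightarrow> 'k data" where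
  "mean_data = (\<lambda>(\<Delta>, \<mu>, \<Omega>0, \<Phi>). (hcat (\<Delta> *\<^sub>R \<mu>) \<mu>, \<Omega>0, \<Phi>))"

lemma column_hcat [simp]: "column 1 (hcat s t) = s" "column 2 (hcat s t) = t"
  by (simp_all add: column_def hcat_def vec_eq_iff)

lemma columns_eq_iff: "R = R' \<longleftrightarrow> column 1 R = column 1 R' \<and> column 2 R = column 2 R'"
  for R R' :: "real^2^'k"
  by (auto simp: column_def vec_eq_iff forall_2)

lemma matrix_vector_mult_columns: "R *v x = x $ 1 *\<^sub>R column 1 R + x $ 2 *\<^sub>R column 2 R"
  for R :: "real^2^'k"
  by (simp add: vec_eq_iff matrix_vector_mult_def column_def sum_2 mult.commute)

section \<open>Elimination of \<open>B0\<close> from the statistics\<close>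

lemma matrix_inv_B0: "matrix_inv (B0 \<beta>) = vector [vector [1, 0], vector [\<beta>, 1]]"
  by (rule matrix_inv_unique) (simp add: B0_def matrix2_simps)

lemma invertible_B0: "invertible (B0 \<beta>)"
  by (simp add: invertible_det_nz det_2 B0_def)

lemma matrix_inv_B0_b_vec: "matrix_inv (B0 \<beta>) *v b_vec \<beta> = vector [1, 0]"
  by (simp add: matrix_inv_B0 b_vec_def matrix2_simps)

lemma transpose_B0_a_vec: "transpose (B0 \<beta>) *v a_vec (\<beta> + \<Delta>) = vector [\<Delta>, 1]"
  unfolding B0_def a_vec_def by (simp add: matrix2_simps del: transpose_matrix_vector)

lemma inner_orig_Omega:
  "x \<bullet> (orig_Omega \<beta> \<Omega> *v y) = (matrix_inv (B0 \<beta>) *v x) \<bullet> (\<Omega> *v (matrix_inv (B0 \<beta>) *v y))"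
  by (simp add: orig_Omega_def inner_transpose del: transpose_matrix_vector
      flip: matrix_vector_mul_assoc)

lemma matrix_inv_orig_Omega:
  assumes "invertible \<Omega>"
  shows "matrix_inv (orig_Omega \<beta> \<Omega>) = B0 \<beta> ** matrix_inv \<Omega> ** transpose (B0 \<beta>)"
proof (rule matrix_inv_unique)
  let ?M = "matrix_inv (B0 \<beta>)"
  have "orig_Omega \<beta> \<Omega> ** (B0 \<beta> ** matrix_inv \<Omega> ** transpose (B0 \<beta>))
      = transpose ?M ** \<Omega> ** (?M ** B0 \<beta>) ** matrix_inv \<Omega> ** transpose (B0 \<beta>)"
    by (simp add: orig_Omega_def matrix_mul_assoc)
  also have "\<dots> = transpose ?M ** (\<Omega> ** matrix_inv \<Omega>) ** transpose (B0 \<beta>)"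
    by (simp add: matrix_inv_mult[OF invertible_B0] matrix_mul_assoc)
  also have "\<dots> = transpose (B0 \<beta> ** ?M)"
    by (simp add: matrix_inv_mult[OF assms] matrix_transpose_mul)
  finally show "orig_Omega \<beta> \<Omega> ** (B0 \<beta> ** matrix_inv \<Omega> ** transpose (B0 \<beta>)) = mat 1"
    by (simp add: matrix_inv_mult[OF invertible_B0] transpose_mat)
qed

lemma inner_b_vec: "b_vec \<beta> \<bullet> (orig_Omega \<beta> \<Omega> *v b_vec \<beta>) = \<Omega> $ 1 $ 1"
  by (simp add: inner_orig_Omega matrix_inv_B0_b_vec) (simp add: matrix2_simps)

lemma matrix_inv_pos_def_2:
  assumes "pos_def \<Omega>"
  shows "matrix_inv \<Omega> *v vector [0, 1] = (1 / det \<Omega>) *\<^sub>R (vector [- \<Omega> $ 1 $ 2, \<Omega> $ 1 $ 1] :: real^2)"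
  using pos_def_2[OF assms] by (simp add: matrix_inv_2 matrix2_simps)

lemma matrix_inv_orig_Omega_a_vec:
  assumes "pos_def \<Omega>"
  shows "matrix_inv (orig_Omega \<beta> \<Omega>) *v a_vec \<beta> =
    (1 / det \<Omega>) *\<^sub>R (B0 \<beta> *v vector [- \<Omega> $ 1 $ 2, \<Omega> $ 1 $ 1])"
  using transpose_B0_a_vec[of \<beta> 0]
  by (simp add: matrix_inv_orig_Omega[OF pos_def_invertible[OF assms]] matrix_inv_pos_def_2[OF assms]
      matrix_vector_mult_scaleR del: transpose_matrix_vector flip: matrix_vector_mul_assoc)

text \<open>General \<open>\<Delta>\<close> gives the numerator of \<open>d\<close>;
  \<open>\<Delta> = 0\<close> gives the normalization shared by \<open>T\<close> and
  \<open>d\<close>.\<close>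

lemma inner_a_vec:
  assumes "pos_def \<Omega>"
  shows "a_vec (\<beta> + \<Delta>) \<bullet> (matrix_inv (orig_Omega \<beta> \<Omega>) *v a_vec \<beta>) =
    (\<Omega> $ 1 $ 1 - \<Delta> * \<Omega> $ 1 $ 2) / det \<Omega>"
proof -
  have "a_vec (\<beta> + \<Delta>) \<bullet> (B0 \<beta> *v w) = vector [\<Delta>, 1] \<bullet> w" for w
    by (metis inner_commute inner_transpose transpose_B0_a_vec)
  then show ?thesis
    by (simp add: matrix_inv_orig_Omega_a_vec[OF assms]) (simp add: matrix2_simps)
qed

text \<open>Merges the factor \<open>1 / det \<Omega>\<close> of the inverse matrix with the
  normalization, for \<open>T\<close> as well as for \<open>d\<close>.\<close>

lemma divide_sqrt_divide:
  fixes w D :: real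
  assumes "w > 0" "D > 0"
  shows "x / D / sqrt (w / D) = x / sqrt (w * D)"
proof -
  have "D * sqrt (w / D) = sqrt w * (D / sqrt D)"
    by (simp add: real_sqrt_divide)
  also have "\<dots> = sqrt (w * D)"
    using assms by (simp add: real_div_sqrt real_sqrt_mult)
  finally show ?thesis by (simp add: divide_divide_eq_left)
qed

text \<open>\<open>B0^-1 b0\<close> is the first unit vector, so \<open>R b0\<close> is the first
  column of \<open>R0\<close>, and \<open>b0' \<Omega> b0\<close> is the corner entry of the
  transformed matrix.\<close>

lemma data_S_std_coords: "data_S \<beta> (R, \<Omega>, \<Phi>) = inv_sqrt \<Phi> *v fst (std_coords (R, \<Omega>, \<Phi>))"
  by (simp add: data_S_def stat_S_def std_coords_def inner_b_vec orig_R_def matrix_inv_B0_b_vec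
      matrix_vector_mult_columns[of R] matrix_vector_mult_scaleR flip: matrix_vector_mul_assoc)

text \<open>After \<open>B0\<close> cancels, \<open>R0\<close> meets the inverse of the transformed
  covariance applied to the second unit vector, which is proportional to the vector with entries
  \<open>- \<Omega> $ 1 $ 2\<close> and \<open>\<Omega> $ 1 $ 1\<close>.\<close>

lemma data_T_std_coords:
  assumes "pos_def \<Omega>"
  shows "data_T \<beta> (R, \<Omega>, \<Phi>) = inv_sqrt \<Phi> *v fst (snd (std_coords (R, \<Omega>, \<Phi>)))"
proof -
  let ?w = "\<Omega> $ 1 $ 1" and ?D = "det \<Omega>"
  let ?t = "?w *\<^sub>R column 2 R - \<Omega> $ 1 $ 2 *\<^sub>R column 1 R"
  have "orig_R \<beta> R *v (matrix_inv (orig_Omega \<beta> \<Omega>) *v a_vec \<beta>) = (1 / ?D) *\<^sub>R ?t"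
    by (simp add: matrix_inv_orig_Omega_a_vec[OF assms] orig_R_def matrix_vector_mult_scaleR
        matrix_inv_vector[OF invertible_B0] matrix_vector_mult_columns[of R]
        flip: matrix_vector_mul_assoc)
  moreover have "a_vec \<beta> \<bullet> (matrix_inv (orig_Omega \<beta> \<Omega>) *v a_vec \<beta>) = ?w / ?D"
    using inner_a_vec[OF assms, of \<beta> 0] by simp
  moreover have "1 / sqrt (?w / ?D) * (1 / ?D) = 1 / sqrt (?w * ?D)"
    using divide_sqrt_divide[of ?w ?D 1] pos_def_2[OF assms] by (simp add: mult.commute)
  ultimately show ?thesis
    by (simp add: data_T_def stat_T_def std_coords_def matrix_vector_mult_scaleR
        del: times_divide_eq_left times_divide_eq_right)
qed

lemma coords_inv_std_coords:
  assumes "x \<in> data_space"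
  shows "coords_inv (std_coords x) = (Q_S \<beta> x, Q_T \<beta> x, \<bar>Q_ST \<beta> x\<bar>)"
proof -
  obtain R \<Omega> \<Phi> where x: "x = (R, \<Omega>, \<Phi>)" "pos_def \<Omega>" "pos_def \<Phi>"
    using assms by (auto simp: data_space_def)
  obtain s t where st: "std_coords (R, \<Omega>, \<Phi>) = (s, t, \<Omega>, \<Phi>)"
    by (simp add: std_coords_def)
  show ?thesis
    using x(2,3) by (simp add: x(1) Q_S_def Q_T_def Q_ST_def data_S_std_coords data_T_std_coords st
        inner_inv_sqrt coords_inv_def)
qed

text \<open>For given \<open>\<Omega>\<close> the columns pass through a triangular linear map whose
  diagonal is nonzero, because the corner entry and the determinant are positive.\<close>

lemma std_coords_inj:
  assumes "x \<in> data_space" "y \<in> data_space" "std_coords x = std_coords y"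
  shows "x = y"
proof -
  obtain R \<Omega> \<Phi> where x: "x = (R, \<Omega>, \<Phi>)" "pos_def \<Omega>"
    using assms(1) by (auto simp: data_space_def)
  obtain R' where y: "y = (R', \<Omega>, \<Phi>)"
    using assms(3) x by (cases y) (simp add: std_coords_def)
  show ?thesis
    using assms(3) pos_def_2[OF x(2)] by (auto simp: x y std_coords_def columns_eq_iff[of R])
qed

section \<open>The actions\<close>

lemma act_data_apply:
  "act_data (g1, g2) (R, \<Omega>, \<Phi>) =
    (g1 ** R ** transpose g2, g2 ** \<Omega> ** transpose g2, g1 ** \<Phi> ** transpose g1)"
  by (simp add: act_data_def act_data1_def act_data2_def matrix_mul_assoc)

lemma act_data_closed:
  assumes "g \<in> GL \<times> GT" "x \<in> data_space"
  shows "act_data g x \<in> data_space"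
  using assms by (cases g; cases x)
    (auto simp: data_space_def act_data_apply GL_def GT_def pos_def_congruence)

lemma columns_congruence:
  fixes g1 :: "real^'k^'k" and g2 :: "real^2^2"
  assumes "g2 $ 1 $ 2 = 0"
  shows "column 1 (g1 ** R ** transpose g2) = g2 $ 1 $ 1 *\<^sub>R (g1 *v column 1 R)"
    "column 2 (g1 ** R ** transpose g2) =
      g2 $ 2 $ 1 *\<^sub>R (g1 *v column 1 R) + g2 $ 2 $ 2 *\<^sub>R (g1 *v column 2 R)"
proof -
  have "column j (g1 ** R ** transpose g2) = g1 *v (R *v (g2 $ j))" for j
    by (simp add: vec_eq_iff column_def matrix_vector_mul_assoc)
      (simp add: matrix_matrix_mult_def matrix_vector_mult_def transpose_def)
  then show "column 1 (g1 ** R ** transpose g2) = g2 $ 1 $ 1 *\<^sub>R (g1 *v column 1 R)"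
    "column 2 (g1 ** R ** transpose g2) =
      g2 $ 2 $ 1 *\<^sub>R (g1 *v column 1 R) + g2 $ 2 $ 2 *\<^sub>R (g1 *v column 2 R)"
    by (simp_all add: matrix_vector_mult_columns[of R] matrix_vector_right_distrib
        matrix_vector_mult_scaleR assms)
qed

text \<open>The contributions of \<open>g2 $ 2 $ 1\<close> to the second coordinate cancel. Writing
  \<open>p\<close>, \<open>q\<close> for the diagonal of \<open>g2\<close>, the factors
  \<open>p\<close> and \<open>p^2 q\<close> that remain are divided by \<open>\<bar>p\<bar>\<close>
  and \<open>p^2 \<bar>q\<bar>\<close> from the normalizations, which leaves the signs.\<close>

lemma std_coords_act_data:
  assumes x: "x \<in> data_space" and g2: "g2 \<in> GT"
  shows "std_coords (act_data (g1, g2) x) = act_funs (g1, g2) (std_coords x)"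
proof -
  obtain R \<Omega> \<Phi> where x: "x = (R, \<Omega>, \<Phi>)" and \<Omega>: "pos_def \<Omega>"
    using x by (auto simp: data_space_def)
  let ?w = "\<Omega> $ 1 $ 1" and ?v = "\<Omega> $ 1 $ 2" and ?D = "det \<Omega>"
  let ?p = "g2 $ 1 $ 1" and ?r = "g2 $ 2 $ 1" and ?q = "g2 $ 2 $ 2"
  let ?G = "g2 ** \<Omega> ** transpose g2"
  have g: "g2 $ 1 $ 2 = 0" "?p \<noteq> 0" "?q \<noteq> 0" using g2 by (auto simp: GT_iff)
  note w = pos_def_2[OF \<Omega>]
  have G11: "?G $ 1 $ 1 = ?p\<^sup>2 * ?w" and G12: "?G $ 1 $ 2 = ?p * (?r * ?w + ?q * ?v)"
    by (simp_all add: matrix2_simps g w(1) power2_eq_square algebra_simps)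
  have dG: "det ?G = (?p * ?q)\<^sup>2 * ?D"
    by (simp add: det_mul det_2[of g2] g power2_eq_square)
  have u: "?p / sqrt (?G $ 1 $ 1) = sgn ?p * (1 / sqrt ?w)"
    using g w by (simp add: G11 real_sqrt_mult sgn_if)
  have "sqrt (?G $ 1 $ 1 * det ?G) = ?p\<^sup>2 * \<bar>?q\<bar> * sqrt (?w * ?D)"
  proof -
    have "?G $ 1 $ 1 * det ?G = (?p\<^sup>2 * ?q)\<^sup>2 * (?w * ?D)"
      by (simp add: G11 dG power2_eq_square)
    then show ?thesis by (simp only: real_sqrt_mult real_sqrt_abs abs_mult abs_power2)
  qed
  then have v: "?p\<^sup>2 * ?q / sqrt (?G $ 1 $ 1 * det ?G) = sgn ?q * (1 / sqrt (?w * ?D))"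
    using g w by (simp add: sgn_if)
  let ?R = "g1 ** R ** transpose g2"
  have "?G $ 1 $ 1 *\<^sub>R column 2 ?R - ?G $ 1 $ 2 *\<^sub>R column 1 ?R =
      (?p\<^sup>2 * ?q) *\<^sub>R (g1 *v (?w *\<^sub>R column 2 R - ?v *\<^sub>R column 1 R))"
    unfolding G11 G12 columns_congruence[OF g(1)]
    by (simp add: matrix_vector_mult_diff_distrib matrix_vector_mult_scaleR)
      (simp add: algebra_simps power2_eq_square)
  then have "(1 / sqrt (?G $ 1 $ 1 * det ?G)) *\<^sub>R
        (?G $ 1 $ 1 *\<^sub>R column 2 ?R - ?G $ 1 $ 2 *\<^sub>R column 1 ?R) =
      (?p\<^sup>2 * ?q / sqrt (?G $ 1 $ 1 * det ?G)) *\<^sub>R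
        (g1 *v (?w *\<^sub>R column 2 R - ?v *\<^sub>R column 1 R))"
    by simp
  moreover have "(1 / sqrt (?G $ 1 $ 1)) *\<^sub>R column 1 ?R = (?p / sqrt (?G $ 1 $ 1)) *\<^sub>R (g1 *v column 1 R)"
    by (simp add: columns_congruence[OF g(1)])
  ultimately show ?thesis
    unfolding u v
    by (simp add: x act_data_apply std_coords_def act_funs_def matrix_vector_mult_scaleR)
qed

text \<open>\<open>g1\<close> preserves the inner products by congruence. The signs are squared in
  the first two components and absorbed by the absolute value in the third.\<close>

lemma coords_inv_act_funs:
  assumes \<Phi>: "invertible \<Phi>" and g: "g1 \<in> GL" "g2 \<in> GT"
  shows "coords_inv (act_funs (g1, g2) (u, v, \<Omega>, \<Phi>)) = coords_inv (u, v, \<Omega>, \<Phi>)"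
proof -
  have "sgn (g2 $ 1 $ 1) * sgn (g2 $ 1 $ 1) = 1" "sgn (g2 $ 2 $ 2) * sgn (g2 $ 2 $ 2) = 1"
    "\<bar>sgn (g2 $ 1 $ 1)\<bar> = 1" "\<bar>sgn (g2 $ 2 $ 2)\<bar> = 1"
    using g(2) by (auto simp: GT_iff sgn_if)
  then show ?thesis
    using inner_inv_congruence[OF \<Phi>, of g1] g(1)
    by (simp add: act_funs_def coords_inv_def matrix_vector_mult_scaleR GL_def abs_mult
        flip: mult.assoc)
qed

lemma coords_inv_act_data:
  assumes "x \<in> data_space" "g \<in> GL \<times> GT"
  shows "coords_inv (std_coords (act_data g x)) = coords_inv (std_coords x)"
proof -
  obtain g1 g2 where g: "g = (g1, g2)" "g1 \<in> GL" "g2 \<in> GT" using assms(2) by auto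
  obtain R \<Omega> \<Phi> where x: "x = (R, \<Omega>, \<Phi>)" "pos_def \<Phi>"
    using assms(1) by (auto simp: data_space_def)
  obtain u v where "std_coords x = (u, v, \<Omega>, \<Phi>)" by (simp add: x std_coords_def)
  then show ?thesis
    using std_coords_act_data[OF assms(1) g(3)] g x(2)
    by (simp add: coords_inv_act_funs pos_def_invertible)
qed

lemma act_data_transitive:
  assumes x: "x \<in> data_space" and y: "y \<in> data_space"
    and eq: "coords_inv (std_coords x) = coords_inv (std_coords y)"
  obtains g where "g \<in> GL \<times> GT" "act_data g x = y"
proof -
  obtain R \<Omega> \<Phi> where x': "x = (R, \<Omega>, \<Phi>)" "pos_def \<Omega>" "pos_def \<Phi>"
    using x by (auto simp: data_space_def)
  obtain R' \<Omega>' \<Phi>' where y': "y = (R', \<Omega>', \<Phi>')" "pos_def \<Omega>'" "pos_def \<Phi>'"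
    using y by (auto simp: data_space_def)
  obtain u v where u: "std_coords x = (u, v, \<Omega>, \<Phi>)" by (simp add: x' std_coords_def)
  obtain u' v' where u': "std_coords y = (u', v', \<Omega>', \<Phi>')" by (simp add: y' std_coords_def)
  define s t s' t' where st: "s = inv_sqrt \<Phi> *v u" "t = inv_sqrt \<Phi> *v v"
    "s' = inv_sqrt \<Phi>' *v u'" "t' = inv_sqrt \<Phi>' *v v'"
  have gram: "s \<bullet> s = s' \<bullet> s'" "t \<bullet> t = t' \<bullet> t'" "\<bar>s \<bullet> t\<bar> = \<bar>s' \<bullet> t'\<bar>"
    using eq x'(3) y'(3) by (simp_all add: st u u' coords_inv_def inner_inv_sqrt)
  \<comment> \<open>Only \<open>\<bar>s \<bullet> t\<bar>\<close> is known; \<open>e\<close> is the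
    sign by which \<open>t\<close> must be flipped. The same \<open>e\<close> becomes the sign of
    the second diagonal entry of \<open>g2\<close>.\<close>
  from gram(3) obtain e :: real where e: "e\<^sup>2 = 1" "s \<bullet> (e *\<^sub>R t) = s' \<bullet> t'"
    by (cases "s \<bullet> t = s' \<bullet> t'") (auto simp: abs_eq_iff intro: that[of 1] that[of "-1"])
  then have "(e *\<^sub>R t) \<bullet> (e *\<^sub>R t) = t' \<bullet> t'"
    using gram(2) by (simp add: power2_eq_square flip: mult.assoc)
  then obtain M where M: "orthogonal_matrix M" "M *v s = s'" "M *v (e *\<^sub>R t) = t'"
    using orthogonal_matrix_pair_exists[OF gram(1) _ e(2)] by metis
  obtain g2 where g2: "g2 \<in> GT" "g2 ** \<Omega> ** transpose g2 = \<Omega>'"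
    "sgn (g2 $ 1 $ 1) = 1" "sgn (g2 $ 2 $ 2) = e"
    using GT_congruence_exists[OF x'(2) y'(2) e(1)] by metis
  let ?P = "mat_sqrt \<Phi>" and ?P' = "mat_sqrt \<Phi>'" and ?K = "inv_sqrt \<Phi>"
  \<comment> \<open>Standardize by the root of \<open>\<Phi>\<close>, rotate, then undo the
    standardization for \<open>\<Phi>'\<close>. In \<open>g1 ** \<Phi> ** transpose g1\<close> the
    inner roots cancel, and then so does \<open>M ** transpose M\<close>.\<close>
  define g1 where "g1 = ?P' ** M ** ?K"
  have MM: "M ** transpose M = mat 1" using M(1) by (simp add: orthogonal_matrix_def)
  have "invertible M" using MM by (rule invertible_right_inverseI)
  then have "g1 \<in> GL"
    using inv_sqrt(5,6)[OF x'(3)] inv_sqrt(5,6)[OF y'(3)] by (simp add: g1_def GL_def invertible_mult)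
  have tP: "transpose ?P = ?P" "transpose ?P' = ?P'"
    using mat_sqrt(1)[OF x'(3)] mat_sqrt(1)[OF y'(3)] by (simp_all add: pos_def_def)
  have "g1 ** \<Phi> ** transpose g1
      = ?P' ** M ** (?K ** ?P) ** transpose (?K ** ?P) ** transpose M ** transpose ?P'"
    using mat_sqrt(2)[OF x'(3)] tP
    by (metis (no_types, lifting) g1_def matrix_mul_assoc matrix_transpose_mul)
  also have "\<dots> = ?P' ** (M ** transpose M) ** transpose ?P'"
    by (simp add: inv_sqrt(4)[OF x'(3)] transpose_mat matrix_mul_assoc)
  also have "\<dots> = \<Phi>'"
    by (simp add: MM tP mat_sqrt(2)[OF y'(3)])
  finally have \<Phi>: "g1 ** \<Phi> ** transpose g1 = \<Phi>'" .
  have "g1 *v u = u'" "e *\<^sub>R (g1 *v v) = v'"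
    using M(2,3) inv_sqrt(1)[OF y'(3)]
    by (simp_all add: g1_def st matrix_vector_mult_scaleR flip: matrix_vector_mul_assoc)
      (metis matrix_vector_mult_scaleR)
  \<comment> \<open>It suffices to match coordinates, since they determine the data point.\<close>
  then have "std_coords (act_data (g1, g2) x) = std_coords y"
    unfolding std_coords_act_data[OF x g2(1)] by (simp add: u u' act_funs_def \<Phi> g2)
  moreover have G: "(g1, g2) \<in> GL \<times> GT" using \<open>g1 \<in> GL\<close> g2(1) by simp
  ultimately have "act_data (g1, g2) x = y"
    using std_coords_inj act_data_closed[OF G x] y by blast
  with G show thesis by (rule that)
qed

section \<open>Orbits\<close>

lemma orbit_data: "orbit_of adm_data act_data x = {act_data g x | g. g \<in> GL \<times> GT}"
  by (simp add: orbit_of_def adm_data_def)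

lemma orbit_funs:
  "orbit_of (adm_funs \<beta>) act_funs z =
    {act_funs g z | g. g \<in> GL \<times> GT} \<inter> param_funs \<beta> ` param_space"
  unfolding orbit_of_def adm_funs_def by blast

lemma act_data_mult:
  "act_data (h1, h2) (act_data (g1, g2) x) = act_data (h1 ** g1, h2 ** g2) x"
  by (cases x) (simp add: act_data_apply matrix_transpose_mul matrix_mul_assoc)

lemma act_data_one: "act_data (mat 1, mat 1) x = x"
  by (cases x) (simp add: act_data_apply transpose_mat)

text \<open>Closure of the group under products gives one inclusion for every element and every
  point; the inverse element turns it into the other.\<close>

lemma orbit_act_data:
  assumes "g \<in> GL \<times> GT"
  shows "orbit_of adm_data act_data (act_data g x) = orbit_of adm_data act_data x"
proof
  have sub: "orbit_of adm_data act_data (act_data g x) \<subseteq> orbit_of adm_data act_data x"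
    if "g \<in> GL \<times> GT" for g x
  proof
    fix y assume "y \<in> orbit_of adm_data act_data (act_data g x)"
    then obtain h where h: "h \<in> GL \<times> GT" "y = act_data h (act_data g x)"
      by (auto simp: orbit_data)
    have "(fst h ** fst g, snd h ** snd g) \<in> GL \<times> GT"
      using h(1) that by (auto simp: GT_mult GL_def invertible_mult)
    moreover have "y = act_data (fst h ** fst g, snd h ** snd g) x"
      unfolding h(2) act_data_mult[symmetric] by simp
    ultimately show "y \<in> orbit_of adm_data act_data x" unfolding orbit_data by blast
  qed
  show "orbit_of adm_data act_data (act_data g x) \<subseteq> orbit_of adm_data act_data x"
    by (rule sub[OF assms])
  obtain g1 g2 where g: "g = (g1, g2)" "g1 \<in> GL" "g2 \<in> GT" using assms by auto
  let ?h = "(matrix_inv g1, matrix_inv g2)"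
  have "act_data ?h (act_data g x) = x"
    using g by (simp add: act_data_mult matrix_inv_mult GL_def GT_def act_data_one)
  moreover have "?h \<in> GL \<times> GT"
    using g by (simp add: GL_def invertible_matrix_inv GT_matrix_inv)
  ultimately show "orbit_of adm_data act_data x \<subseteq> orbit_of adm_data act_data (act_data g x)"
    using sub by metis
qed

lemma orbit_data_eqI:
  assumes "x \<in> data_space" "y \<in> data_space"
    and "coords_inv (std_coords x) = coords_inv (std_coords y)"
  shows "orbit_of adm_data act_data x = orbit_of adm_data act_data y"
  using act_data_transitive[OF assms] orbit_act_data by metis

section \<open>Transfer from data to parameters through the mean\<close>

lemma mean_data_in_data_space: "p \<in> param_space \<Longrightarrow> mean_data p \<in> data_space"
  by (auto simp: param_space_def data_space_def mean_data_def)

text \<open>The new \<open>\<mu>\<close> is the second column of the transformed mean. The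
  denominator in the new \<open>\<Delta>\<close> cancels against the scalar in the new
  \<open>\<mu>\<close>, which is where admissibility enters.\<close>

lemma mean_data_act_param:
  assumes "adm_param g p"
  shows "mean_data (act_param g p) = act_data g (mean_data p)"
proof -
  obtain g1 g2 where g: "g = (g1, g2)" by (cases g)
  obtain \<Delta> \<mu> \<Omega> \<Phi> where p: "p = (\<Delta>, \<mu>, \<Omega>, \<Phi>)" by (cases p)
  have a: "g2 $ 1 $ 2 = 0" "\<Delta> * g2 $ 2 $ 1 + g2 $ 2 $ 2 \<noteq> 0"
    using assms by (auto simp: g p adm_param_def GT_iff)
  then show ?thesis
    unfolding g p act_param_def mean_data_def prod.case act_data_apply
      prod.inject columns_eq_iff columns_congruence[OF a(1)] column_hcat
    by (simp add: matrix_vector_mult_scaleR) (simp add: algebra_simps)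
qed

text \<open>\<open>c \<mu>\<close> and \<open>d \<mu>\<close> are what \<open>S\<close> and
  \<open>T\<close>, without their root of \<open>\<Phi>\<close>, become when \<open>R0\<close> is
  replaced by its mean. All parameter statements reduce to data statements by this identity.\<close>

lemma param_funs_eq:
  assumes "p \<in> param_space"
  shows "param_funs \<beta> p = std_coords (mean_data p)"
proof -
  obtain \<Delta> \<mu> \<Omega> \<Phi> where p: "p = (\<Delta>, \<mu>, \<Omega>, \<Phi>)" "pos_def \<Omega>"
    using assms by (auto simp: param_space_def)
  let ?w = "\<Omega> $ 1 $ 1" and ?D = "det \<Omega>"
  have "param_d \<beta> p = (?w - \<Delta> * \<Omega> $ 1 $ 2) / ?D / sqrt (?w / ?D)"
    using inner_a_vec[OF p(2), of \<beta> 0]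
    by (simp add: p(1) param_d_def d_fun_def inner_a_vec[OF p(2)])
  also have "\<dots> = (?w - \<Delta> * \<Omega> $ 1 $ 2) / sqrt (?w * ?D)"
    using pos_def_2[OF p(2)] by (intro divide_sqrt_divide)
  finally have d: "param_d \<beta> p = (?w - \<Delta> * \<Omega> $ 1 $ 2) / sqrt (?w * ?D)" .
  have c: "param_c \<beta> p = \<Delta> / sqrt ?w"
    by (simp add: p(1) param_c_def c_fun_def inner_b_vec)
  have "?w *\<^sub>R \<mu> - \<Omega> $ 1 $ 2 *\<^sub>R \<Delta> *\<^sub>R \<mu> = (?w - \<Delta> * \<Omega> $ 1 $ 2) *\<^sub>R \<mu>"
    by (simp add: scaleR_diff_left mult.commute)
  then show ?thesis
    using c d by (simp add: p(1) param_funs_def std_coords_def mean_data_def)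
qed

text \<open>Since \<open>\<lambda>\<close> is nonnegative, it may be moved inside the absolute
  value.\<close>

lemma param_inv_eq:
  assumes "p \<in> param_space"
  shows "param_inv \<beta> p = coords_inv (param_funs \<beta> p)"
proof -
  obtain \<Delta> \<mu> \<Omega> \<Phi> where p: "p = (\<Delta>, \<mu>, \<Omega>, \<Phi>)" "pos_def \<Phi>"
    using assms by (auto simp: param_space_def)
  have "\<mu> \<bullet> (matrix_inv \<Phi> *v \<mu>) \<ge> 0"
    by (simp flip: inner_inv_sqrt[OF p(2)])
  then show ?thesis
    by (simp add: p(1) param_inv_def param_lambda_def param_funs_def coords_inv_def
        matrix_vector_mult_scaleR abs_mult power2_eq_square)
qed

lemma param_funs_act_param:
  assumes p: "p \<in> param_space" and g: "adm_param g p"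
  shows "param_funs \<beta> (act_param g p) = act_funs g (param_funs \<beta> p)"
    "param_inv \<beta> (act_param g p) = param_inv \<beta> p"
proof -
  obtain g1 g2 where g': "g = (g1, g2)" "g1 \<in> GL" "g2 \<in> GT"
    using g by (cases g; cases p) (auto simp: adm_param_def)
  have q: "act_param g p \<in> param_space"
    using p g' by (cases p)
      (auto simp: param_space_def act_param_def GL_def GT_def pos_def_congruence)
  note m = mean_data_in_data_space[OF p]
  show funs: "param_funs \<beta> (act_param g p) = act_funs g (param_funs \<beta> p)"
    unfolding param_funs_eq[OF p] param_funs_eq[OF q] mean_data_act_param[OF g]
    by (simp add: g'(1) std_coords_act_data[OF m g'(3)])
  show "param_inv \<beta> (act_param g p) = param_inv \<beta> p"
    unfolding param_inv_eq[OF p] param_inv_eq[OF q] param_funs_eq[OF p] param_funs_eq[OF q]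
      mean_data_act_param[OF g]
    by (rule coords_inv_act_data[OF m]) (simp add: g')
qed

text \<open>If \<open>\<mu> \<noteq> 0\<close>, then \<open>p\<close> is determined by \<open>mean_data p\<close>, and an element of the group is
  admissible at \<open>p\<close> as soon as it maps \<open>mean_data p\<close> to the mean of a parameter with nonzero
  \<open>\<mu>\<close>.\<close>

lemma orbit_param:
  assumes "fst (snd p) \<noteq> 0"
  shows "orbit_of adm_param act_param p =
    {q. fst (snd q) \<noteq> 0 \<and> mean_data q \<in> orbit_of adm_data act_data (mean_data p)}"
proof (intro equalityI subsetI)
  fix q assume "q \<in> orbit_of adm_param act_param p"
  then obtain g where g: "adm_param g p" "q = act_param g p" by (auto simp: orbit_of_def)
  obtain g1 g2 where g': "g = (g1, g2)" "g1 \<in> GL" "g2 \<in> GT"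
    using g by (cases g; cases p) (auto simp: adm_param_def)
  obtain \<Delta> \<mu> \<Omega> \<Phi> where p: "p = (\<Delta>, \<mu>, \<Omega>, \<Phi>)" by (cases p)
  have "g1 *v \<mu> \<noteq> 0"
    using matrix_inv_vector(2)[of g1 \<mu>] g'(2) assms by (auto simp: GL_def p)
  then have "fst (snd q) \<noteq> 0"
    using g by (simp add: g' p act_param_def adm_param_def)
  moreover have "mean_data q \<in> orbit_of adm_data act_data (mean_data p)"
    using mean_data_act_param[OF g(1)] g(2) g' by (auto simp: orbit_data)
  ultimately show "q \<in> {q. fst (snd q) \<noteq> 0 \<and> mean_data q \<in> orbit_of adm_data act_data (mean_data p)}"
    by simp
next
  fix q
  assume "q \<in> {q. fst (snd q) \<noteq> 0 \<and> mean_data q \<in> orbit_of adm_data act_data (mean_data p)}"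
  then have q0: "fst (snd q) \<noteq> 0" and "mean_data q \<in> orbit_of adm_data act_data (mean_data p)"
    by auto
  then obtain g1 g2 where g: "g1 \<in> GL" "g2 \<in> GT" "mean_data q = act_data (g1, g2) (mean_data p)"
    by (auto simp: orbit_data)
  obtain \<Delta> \<mu> \<Omega> \<Phi> where p: "p = (\<Delta>, \<mu>, \<Omega>, \<Phi>)" by (cases p)
  obtain \<Delta>' \<mu>' \<Omega>' \<Phi>' where q: "q = (\<Delta>', \<mu>', \<Omega>', \<Phi>')" by (cases q)
  have g12: "g2 $ 1 $ 2 = 0" using g(2) by (simp add: GT_iff)
  let ?e = "\<Delta> * g2 $ 2 $ 1 + g2 $ 2 $ 2"
  from g(3) have "column 1 (hcat (\<Delta>' *\<^sub>R \<mu>') \<mu>') = column 1 (g1 ** hcat (\<Delta> *\<^sub>R \<mu>) \<mu> ** transpose g2)"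
    and "column 2 (hcat (\<Delta>' *\<^sub>R \<mu>') \<mu>') = column 2 (g1 ** hcat (\<Delta> *\<^sub>R \<mu>) \<mu> ** transpose g2)"
    and rest: "\<Omega>' = g2 ** \<Omega> ** transpose g2" "\<Phi>' = g1 ** \<Phi> ** transpose g1"
    by (simp_all add: p q mean_data_def act_data_apply)
  then have c1: "\<Delta>' *\<^sub>R \<mu>' = (g2 $ 1 $ 1 * \<Delta>) *\<^sub>R (g1 *v \<mu>)" and c2: "\<mu>' = ?e *\<^sub>R (g1 *v \<mu>)"
    by (simp_all add: columns_congruence[OF g12] matrix_vector_mult_scaleR algebra_simps)
  \<comment> \<open>The nonzero \<open>\<mu>'\<close> is the product of \<open>?e\<close> and
    \<open>g1 *v \<mu>\<close>, so neither vanishes. Cancelling the vector then yields the formula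
    for \<open>\<Delta>'\<close>.\<close>
  have "g1 *v \<mu> \<noteq> 0" and e: "?e \<noteq> 0" using q0 c2 by (auto simp: q)
  moreover have "(\<Delta>' * ?e) *\<^sub>R (g1 *v \<mu>) = (g2 $ 1 $ 1 * \<Delta>) *\<^sub>R (g1 *v \<mu>)"
    using c1 unfolding c2 by simp
  ultimately have "\<Delta>' * ?e = \<Delta> * g2 $ 1 $ 1"
    by (simp add: mult.commute)
  then have "q = act_param (g1, g2) p"
    using e c2 rest by (simp add: p q act_param_def eq_divide_eq)
  moreover have "adm_param (g1, g2) p"
    using g e by (simp add: p adm_param_def)
  ultimately show "q \<in> orbit_of adm_param act_param p"
    by (auto simp: orbit_of_def)
qed

section \<open>Maximal invariants\<close>

lemma maximal_invariant_data:
  "maximal_invariant_on data_space adm_data act_data (\<lambda>x. (Q_S \<beta> x, Q_T \<beta> x, (Q_ST \<beta> x)\<^sup>2))"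
proof -
  \<comment> \<open>\<open>Q_ST^2\<close> and \<open>\<bar>Q_ST\<bar>\<close> separate the same
    points, so \<open>coords_inv\<close> may replace the stated triple.\<close>
  have iff: "(Q_S \<beta> x, Q_T \<beta> x, (Q_ST \<beta> x)\<^sup>2) = (Q_S \<beta> y, Q_T \<beta> y, (Q_ST \<beta> y)\<^sup>2) \<longleftrightarrow>
      coords_inv (std_coords x) = coords_inv (std_coords y)"
    if "x \<in> data_space" "y \<in> data_space" for x y :: "'a data"
    using that by (simp add: coords_inv_std_coords[of _ \<beta>] power2_eq_iff abs_eq_iff)
  show ?thesis
    unfolding maximal_invariant_on_def invariant_on_def
  proof (intro conjI ballI impI)
    fix x y :: "'a data"
    assume x: "x \<in> data_space" and "y \<in> orbit_of adm_data act_data x"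
    then obtain g where g: "g \<in> GL \<times> GT" "y = act_data g x" by (auto simp: orbit_data)
    then show "(Q_S \<beta> y, Q_T \<beta> y, (Q_ST \<beta> y)\<^sup>2) = (Q_S \<beta> x, Q_T \<beta> x, (Q_ST \<beta> x)\<^sup>2)"
      using iff[of y x] x act_data_closed[OF g(1) x] coords_inv_act_data[OF x g(1)] by blast
  next
    fix x y :: "'a data"
    assume "x \<in> data_space" "y \<in> data_space"
      "orbit_of adm_data act_data x \<noteq> orbit_of adm_data act_data y"
    then show "(Q_S \<beta> x, Q_T \<beta> x, (Q_ST \<beta> x)\<^sup>2) \<noteq> (Q_S \<beta> y, Q_T \<beta> y, (Q_ST \<beta> y)\<^sup>2)"
      using iff orbit_data_eqI by blast
  qed
qed

lemma invariant_param: "invariant_on param_space adm_param act_param (param_inv \<beta>)"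
  by (auto simp: invariant_on_def orbit_of_def param_funs_act_param(2))

text \<open>Equal invariants put the two means on one data orbit. For
  \<open>\<mu> \<noteq> 0\<close> the parameter orbit is recovered from the data orbit of the mean
  by \<open>orbit_param\<close>.\<close>

lemma maximal_invariant_param:
  "maximal_invariant_on {(\<Delta>, \<mu>, \<Omega>0, \<Phi>) \<in> param_space. \<mu> \<noteq> 0} adm_param act_param (param_inv \<beta>)"
  unfolding maximal_invariant_on_def
proof (intro conjI ballI impI notI)
  show "invariant_on {(\<Delta>, \<mu>, \<Omega>0, \<Phi>) \<in> param_space. \<mu> \<noteq> 0} adm_param act_param (param_inv \<beta>)"
    using invariant_param[of \<beta>] by (auto simp: invariant_on_def)
  fix p q :: "'a param"
  assume "p \<in> {(\<Delta>, \<mu>, \<Omega>0, \<Phi>) \<in> param_space. \<mu> \<noteq> 0}" "q \<in> {(\<Delta>, \<mu>, \<Omega>0, \<Phi>) \<in> param_space. \<mu> \<noteq> 0}"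
  then have p: "p \<in> param_space" "fst (snd p) \<noteq> 0" and q: "q \<in> param_space" "fst (snd q) \<noteq> 0"
    by auto
  assume "param_inv \<beta> p = param_inv \<beta> q"
  then have "orbit_of adm_data act_data (mean_data p) = orbit_of adm_data act_data (mean_data q)"
    using p q by (intro orbit_data_eqI mean_data_in_data_space) (simp_all add: param_inv_eq param_funs_eq)
  moreover assume "orbit_of adm_param act_param p \<noteq> orbit_of adm_param act_param q"
  ultimately show False by (simp add: orbit_param p q)
qed

lemma maximal_invariant_funs:
  "maximal_invariant_on (param_funs \<beta> ` param_space) (adm_funs \<beta>) act_funs coords_inv"
proof -
  \<comment> \<open>By equivariance, orbits in the function space are images of data orbits, cut
    down to the range of \<open>param_funs\<close>. Equal data orbits of the means thus suffice,
    even for \<open>\<mu> = 0\<close>.\<close>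
  have orbit: "orbit_of (adm_funs \<beta>) act_funs (param_funs \<beta> p) =
      std_coords ` orbit_of adm_data act_data (mean_data p) \<inter> param_funs \<beta> ` param_space"
    if p: "p \<in> param_space" for p :: "'a param"
  proof -
    have "std_coords (act_data g (mean_data p)) = act_funs g (param_funs \<beta> p)" if "g \<in> GL \<times> GT" for g
      using std_coords_act_data[OF mean_data_in_data_space[OF p], of "snd g" "fst g"] that
      by (simp add: param_funs_eq[OF p] mem_Times_iff)
    then have "{act_funs g (param_funs \<beta> p) | g. g \<in> GL \<times> GT} =
        std_coords ` {act_data g (mean_data p) | g. g \<in> GL \<times> GT}"
      unfolding image_def by (blast intro: sym)
    then show ?thesis by (simp only: orbit_funs orbit_data)
  qed
  show ?thesis
    unfolding maximal_invariant_on_def invariant_on_def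
  proof (intro conjI ballI impI)
    fix z w :: "(real^'a) \<times> (real^'a) \<times> (real^2^2) \<times> (real^'a^'a)"
    assume "z \<in> param_funs \<beta> ` param_space" and w: "w \<in> orbit_of (adm_funs \<beta>) act_funs z"
    then obtain p where p: "p \<in> param_space" "z = param_funs \<beta> p" by blast
    from w obtain g where g: "g \<in> GL \<times> GT" "w = std_coords (act_data g (mean_data p))"
      by (auto simp: p(2) orbit[OF p(1)] orbit_data)
    then show "coords_inv w = coords_inv z"
      using coords_inv_act_data[OF mean_data_in_data_space[OF p(1)] g(1)]
      by (simp add: p(2) param_funs_eq[OF p(1)])
  next
    fix z w :: "(real^'a) \<times> (real^'a) \<times> (real^2^2) \<times> (real^'a^'a)"
    assume "z \<in> param_funs \<beta> ` param_space" "w \<in> param_funs \<beta> ` param_space"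
    then obtain p q where pq: "p \<in> param_space" "z = param_funs \<beta> p" "q \<in> param_space" "w = param_funs \<beta> q"
      by blast
    assume ne: "orbit_of (adm_funs \<beta>) act_funs z \<noteq> orbit_of (adm_funs \<beta>) act_funs w"
    show "coords_inv z \<noteq> coords_inv w"
    proof
      assume "coords_inv z = coords_inv w"
      then have "orbit_of adm_data act_data (mean_data p) = orbit_of adm_data act_data (mean_data q)"
        using pq by (intro orbit_data_eqI mean_data_in_data_space) (simp_all add: param_funs_eq)
      with ne show False by (simp add: pq orbit)
    qed
  qed
qed

lemma data_stats_act_data2:
  assumes g2: "g2 \<in> GT" and x: "(R0, \<Omega>0, \<Phi>) \<in> data_space"
  shows "data_stats \<beta> (act_data2 g2 (R0, \<Omega>0, \<Phi>)) =
    (hcat (sgn (g2 $ 1 $ 1) *\<^sub>R data_S \<beta> (R0, \<Omega>0, \<Phi>)) (sgn (g2 $ 2 $ 2) *\<^sub>R data_T \<beta> (R0, \<Omega>0, \<Phi>)),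
     g2 ** \<Omega>0 ** transpose g2, \<Phi>)"
proof -
  have pd: "pos_def \<Omega>0" "pos_def (g2 ** \<Omega>0 ** transpose g2)"
    using x g2 by (auto simp: data_space_def GT_def pos_def_congruence)
  obtain s t where st: "std_coords (R0, \<Omega>0, \<Phi>) = (s, t, \<Omega>0, \<Phi>)" by (simp add: std_coords_def)
  have "std_coords (R0 ** transpose g2, g2 ** \<Omega>0 ** transpose g2, \<Phi>) =
      (sgn (g2 $ 1 $ 1) *\<^sub>R s, sgn (g2 $ 2 $ 2) *\<^sub>R t, g2 ** \<Omega>0 ** transpose g2, \<Phi>)"
    using std_coords_act_data[OF x g2, of "mat 1"]
    by (simp add: act_data_apply st act_funs_def transpose_mat)
  then show ?thesis
    by (simp add: act_data2_def data_stats_def data_S_std_coords data_T_std_coords pd st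
        matrix_vector_mult_scaleR)
qed

lemma param_funs_act_param2:
  assumes "(\<Delta>, \<mu>, \<Omega>0, \<Phi>) \<in> param_space" "adm_param (mat 1, g2) (\<Delta>, \<mu>, \<Omega>0, \<Phi>)"
  shows "param_funs \<beta> (act_param (mat 1, g2) (\<Delta>, \<mu>, \<Omega>0, \<Phi>)) =
    (sgn (g2 $ 1 $ 1) *\<^sub>R (param_c \<beta> (\<Delta>, \<mu>, \<Omega>0, \<Phi>) *\<^sub>R \<mu>),
     sgn (g2 $ 2 $ 2) *\<^sub>R (param_d \<beta> (\<Delta>, \<mu>, \<Omega>0, \<Phi>) *\<^sub>R \<mu>),
     g2 ** \<Omega>0 ** transpose g2, \<Phi>)"
  using param_funs_act_param(1)[OF assms, of \<beta>]
  by (simp add: act_funs_def param_funs_def transpose_mat)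

theorem theorem2:
  fixes \<beta>0 :: real
  shows
    "(\<forall>g2\<in>GT. \<forall>(R0, \<Omega>0, \<Phi>)\<in>(data_space :: 'k::finite data set).
       data_stats \<beta>0 (act_data2 g2 (R0, \<Omega>0, \<Phi>)) =
         (hcat (sgn (g2 $ 1 $ 1) *\<^sub>R data_S \<beta>0 (R0, \<Omega>0, \<Phi>))
               (sgn (g2 $ 2 $ 2) *\<^sub>R data_T \<beta>0 (R0, \<Omega>0, \<Phi>)),
          g2 ** \<Omega>0 ** transpose g2, \<Phi>)) \<and>
     maximal_invariant_on (data_space :: 'k data set) adm_data act_data
       (\<lambda>x. (Q_S \<beta>0 x, Q_T \<beta>0 x, (Q_ST \<beta>0 x)\<^sup>2)) \<and>
     (\<forall>g2\<in>GT. \<forall>(\<Delta>, \<mu>, \<Omega>0, \<Phi>)\<in>(param_space :: 'k param set).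
       adm_param (mat 1, g2) (\<Delta>, \<mu>, \<Omega>0, \<Phi>) \<longrightarrow>
       param_funs \<beta>0 (act_param (mat 1, g2) (\<Delta>, \<mu>, \<Omega>0, \<Phi>)) =
         (sgn (g2 $ 1 $ 1) *\<^sub>R (param_c \<beta>0 (\<Delta>, \<mu>, \<Omega>0, \<Phi>) *\<^sub>R \<mu>),
          sgn (g2 $ 2 $ 2) *\<^sub>R (param_d \<beta>0 (\<Delta>, \<mu>, \<Omega>0, \<Phi>) *\<^sub>R \<mu>),
          g2 ** \<Omega>0 ** transpose g2, \<Phi>)) \<and>
     (invariant_on (param_space :: 'k param set) adm_param act_param (param_inv \<beta>0) \<and>
      maximal_invariant_on {(\<Delta>, \<mu>, \<Omega>0, \<Phi>) \<in> (param_space :: 'k param set). \<mu> \<noteq> 0}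
        adm_param act_param (param_inv \<beta>0) \<and>
      (\<forall>g. \<forall>p\<in>(param_space :: 'k param set). adm_param g p \<longrightarrow>
        param_funs \<beta>0 (act_param g p) = act_funs g (param_funs \<beta>0 p)) \<and>
      (\<exists>h. (\<forall>p\<in>(param_space :: 'k param set). param_inv \<beta>0 p = h (param_funs \<beta>0 p)) \<and>
         maximal_invariant_on (param_funs \<beta>0 ` (param_space :: 'k param set))
           (adm_funs \<beta>0) act_funs h))"
  \<comment> \<open>\<open>coords_inv\<close> is the function through which \<open>param_inv\<close>
    factors over \<open>param_funs\<close>.\<close>
  by (intro conjI exI[of _ coords_inv])
    (use data_stats_act_data2 maximal_invariant_data param_funs_act_param2 invariant_param
      maximal_invariant_param param_funs_act_param(1) param_inv_eq maximal_invariant_funs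
      in \<open>blast+\<close>)

end
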